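(* Let $\{f_j\}_1^n$ be a frame for a subspace $\mathcal{K}\subseteq\mathbb{C}^m$ with synthesis matrix $F$. Fix a subspace $\mathcal{S}\subseteq\mathbb{C}^m$ such that $\mathcal{K}$ is not included in $\mathcal{S}^\perp$. Set $k=\#\{j : s_j(P_{\mathcal{S}}F)\ge1/2\}$, and put $k=1$ if $s_j(P_{\mathcal{S}}F)<1/2$ for all $j\ge1$. Then a symmetric approximation of $\{f_j\}_1^n$ in $\mathcal{J}_{\mathcal{S}}$ is given by $$u_j=V\begin{bmatrix} I_k&0\\0&0_{m-k,n-k}\end{bmatrix}W^*e_j,\qquad j=1,\dots,n,$$ where $V$ and $W$ are any pair of unitary matrices such that $P_{\mathcal{S}}F=V\Sigma W^*$ is a singular value decomposition.
   Context: A finite family $\{f_j\}_1^n$ of vectors in $\mathbb{C}^m$ is a frame for a subspace $\mathcal{K}$ if it spans $\mathcal{K}$; it is a Parseval frame for $\mathcal{K}$ if moreover $\|f\|^2=\sum_{j=1}^n|\langle f,f_j\rangle|^2$ for all $f\in\mathcal{K}$. The synthesis matrix of $\{f_j\}_1^n$ is the $m\times n$ matrix with columns $f_1,\dots,f_n$. An $n$-Parseval frame is a family of $n$ vectors in $\mathbb{C}^m$ (repetitions allowed) that is a Parseval frame for some nonzero subspace of $\mathbb{C}^m$ (the subspace is not fixed). $P_{\mathcal{S}}$ is the orthogonal projection onto $\mathcal{S}$, and $\mathcal{J}_{\mathcal{S}}$ is the family of all $n$-Parseval frames whose vectors belong to $\mathcal{S}$. For a family $\mathcal{J}$ of $n$-Parseval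 frames, $\{u_j\}_1^n\in\mathcal{J}$ is a symmetric approximation of $\{f_j\}_1^n$ in $\mathcal{J}$ if $\sum_{j=1}^n\|f_j-u_j\|^2\le\sum_{j=1}^n\|f_j-x_j\|^2$ for all $\{x_j\}_1^n\in\mathcal{J}$. $\{e_j\}_1^n$ is the standard basis of $\mathbb{C}^n$. For an $m\times n$ matrix $G$ of rank $r$, with $q=\min\{m,n\}$, $s_1(G)\ge\dots\ge s_q(G)\ge0$ are its singular values, and a singular value decomposition is $G=V\Sigma W^*$ with $V$ ($m\times m$) and $W$ ($n\times n$) unitary and $\Sigma=\begin{bmatrix}\Sigma_r&0\\0&0_{m-r,n-r}\end{bmatrix}$, $\Sigma_r=\mathrm{diag}(s_1(G),\dots,s_r(G))$. *)

theory Defs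
  imports
    "HOL-Computational_Algebra.Polynomial"
    "Jordan_Normal_Form.Schur_Decomposition"
    "Jordan_Normal_Form.DL_Rank"
begin

text \<open>
  Vectors and matrices over \<open>\<complex>\<close> are those of Jordan-Normal-Form, with explicit dimensions.
  All indices start at 0: a family of \<open>n\<close> vectors is a function \<open>f :: nat \<Rightarrow> complex vec\<close> of
  which only the values \<open>f j\<close> with \<open>j < n\<close> matter. The inner product, linear in its first
  argument, is \<open>x \<bullet>c y\<close>.
\<close>

abbreviation cspace :: "nat \<Rightarrow> (complex, complex vec) module" where
  "cspace m \<equiv> module_vec TYPE(complex) m"

definition csubspace :: "nat \<Rightarrow> complex vec set \<Rightarrow> bool" where
  "csubspace m S \<longleftrightarrow> VectorSpace.subspace class_ring S (cspace m)"

definition cspan :: "nat \<Rightarrow> complex vec set \<Rightarrow> complex vec set" where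
  "cspan m A = LinearCombinations.module.span class_ring (cspace m) A"

definition cnorm :: "complex vec \<Rightarrow> real" where
  "cnorm v = sqrt (Re (v \<bullet>c v))"

text \<open>
  Not the library's \<open>orthogonal_complement\<close>, which uses the bilinear product without conjugation.
\<close>

definition orth_compl :: "nat \<Rightarrow> complex vec set \<Rightarrow> complex vec set" where
  "orth_compl m S = {x \<in> carrier_vec m. \<forall>y\<in>S. x \<bullet>c y = 0}"

definition orth_proj :: "nat \<Rightarrow> complex vec set \<Rightarrow> complex mat" where
  "orth_proj m S = (THE P. P \<in> carrier_mat m m \<and>
     (\<forall>x\<in>carrier_vec m. P *\<^sub>v x \<in> S \<and> x - P *\<^sub>v x \<in> orth_compl m S))"

definition synthesis_mat :: "nat \<Rightarrow> nat \<Rightarrow> (nat \<Rightarrow> complex vec) \<Rightarrow> complex mat" where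
  "synthesis_mat m n f = mat_of_cols m (map f [0..<n])"

definition frame_for :: "nat \<Rightarrow> nat \<Rightarrow> (nat \<Rightarrow> complex vec) \<Rightarrow> complex vec set \<Rightarrow> bool" where
  "frame_for m n f K \<longleftrightarrow>
     csubspace m K \<and> (\<forall>j<n. f j \<in> carrier_vec m) \<and> cspan m (f ` {..<n}) = K"

definition parseval_frame_for :: "nat \<Rightarrow> nat \<Rightarrow> (nat \<Rightarrow> complex vec) \<Rightarrow> complex vec set \<Rightarrow> bool" where
  "parseval_frame_for m n f K \<longleftrightarrow>
     frame_for m n f K \<and> (\<forall>g\<in>K. (cnorm g)\<^sup>2 = (\<Sum>j<n. (cmod (g \<bullet>c f j))\<^sup>2))"

definition n_parseval_frame :: "nat \<Rightarrow> nat \<Rightarrow> (nat \<Rightarrow> complex vec) \<Rightarrow> bool" where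
  "n_parseval_frame m n f \<longleftrightarrow> (\<exists>K. K \<noteq> {0\<^sub>v m} \<and> parseval_frame_for m n f K)"

definition n_parseval_frames_in :: "nat \<Rightarrow> nat \<Rightarrow> complex vec set \<Rightarrow> (nat \<Rightarrow> complex vec) set" where
  "n_parseval_frames_in m n S = {x. n_parseval_frame m n x \<and> (\<forall>j<n. x j \<in> S)}"

definition symmetric_approximation ::
    "nat \<Rightarrow> (nat \<Rightarrow> complex vec) set \<Rightarrow> (nat \<Rightarrow> complex vec) \<Rightarrow> (nat \<Rightarrow> complex vec) \<Rightarrow> bool" where
  "symmetric_approximation n J f u \<longleftrightarrow>
     u \<in> J \<and> (\<forall>x\<in>J. (\<Sum>j<n. (cnorm (f j - u j))\<^sup>2) \<le> (\<Sum>j<n. (cnorm (f j - x j))\<^sup>2))"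

definition unitary_mat :: "nat \<Rightarrow> complex mat \<Rightarrow> bool" where
  "unitary_mat n U \<longleftrightarrow>
     U \<in> carrier_mat n n \<and> U * mat_adjoint U = 1\<^sub>m n \<and> mat_adjoint U * U = 1\<^sub>m n"

text \<open>
  The square roots of the \<open>min m n\<close> largest eigenvalues of \<open>G\<^sup>*G\<close>, counted with algebraic
  multiplicity and in decreasing order. The eigenvalues are real and nonnegative, so \<open>Re\<close> loses
  nothing; those cut off by \<open>take\<close> when \<open>n > m\<close> are zero.
\<close>

definition singular_values :: "complex mat \<Rightarrow> real list" where
  "singular_values G = take (min (dim_row G) (dim_col G))
     (rev (sorted_list_of_multiset
       (image_mset (\<lambda>x. sqrt (Re x)) (proots (char_poly (mat_adjoint G * G))))))"

abbreviation singular_value :: "complex mat \<Rightarrow> nat \<Rightarrow> real" where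
  "singular_value G j \<equiv> singular_values G ! j"

definition embed_block :: "nat \<Rightarrow> nat \<Rightarrow> nat \<Rightarrow> complex mat \<Rightarrow> complex mat" where
  "embed_block m n r A =
     four_block_mat A (0\<^sub>m r (n - r)) (0\<^sub>m (m - r) r) (0\<^sub>m (m - r) (n - r))"

definition is_svd :: "complex mat \<Rightarrow> complex mat \<Rightarrow> complex mat \<Rightarrow> complex mat \<Rightarrow> bool" where
  "is_svd G V \<Sigma> W \<longleftrightarrow>
     (let m = dim_row G; n = dim_col G; r = vec_space.rank m G in
       unitary_mat m V \<and> unitary_mat n W \<and>
       \<Sigma> = embed_block m n r (mat_diag r (\<lambda>j. complex_of_real (singular_value G j))) \<and>
       G = V * \<Sigma> * mat_adjoint W)"

end

theory Submission
  imports Defs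
begin

text \<open>
  Let \<open>X\<close> be the synthesis matrix of a competing frame \<open>x\<close> with vectors in \<open>S\<close>, let \<open>P\<close> be the
  orthogonal projection onto \<open>S\<close>, and let \<open>v\<^sub>i\<close>, \<open>w\<^sub>i\<close> and \<open>s\<^sub>i\<close> be the singular vectors and values of
  \<open>G = P F\<close>. Because the vectors of \<open>x\<close> lie in \<open>S\<close>, only \<open>G\<close> matters in the mixed term, and the
  objective becomes
  \<open>\<parallel>F - X\<parallel>\<^sup>2 = \<parallel>F\<parallel>\<^sup>2 - 2 \<Sum>\<^sub>i s\<^sub>i Re \<langle>v\<^sub>i, X w\<^sub>i\<rangle> + l\<close> with \<open>l = \<parallel>X\<parallel>\<^sup>2\<close> in Frobenius norms
  (\<open>objective_expansion\<close>).

  A Parseval frame has a partial isometry \<open>X\<close> as synthesis matrix. This enters through three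
  consequences. First, \<open>Re \<langle>v\<^sub>i, X w\<^sub>i\<rangle>\<close> is at most
  \<open>b\<^sub>i = (\<parallel>X\<^sup>* v\<^sub>i\<parallel>\<^sup>2 + \<parallel>X w\<^sub>i\<parallel>\<^sup>2) / 2\<close> (\<open>parseval_synthesis_cinner_le\<close>). Second, \<open>0 \<le> b\<^sub>i \<le> 1\<close>, as \<open>X\<close>
  and \<open>X\<^sup>*\<close> are contractions, while \<open>\<Sum>\<^sub>i b\<^sub>i \<le> l\<close>, as the Frobenius norm of \<open>X\<close> can be computed in the
  orthonormal bases \<open>v\<close> and \<open>w\<close>. Third, \<open>l \<ge> 1\<close>, as the spanned subspace is nonzero
  (\<open>parseval_norm_ge_1\<close>).

  What remains is to bound \<open>l - 2 \<Sum>\<^sub>i s\<^sub>i b\<^sub>i\<close> from below under these constraints. The minimum is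
  \<open>\<Sum>\<^sub>i\<^sub><\<^sub>k (1 - 2 s\<^sub>i)\<close>: a unit of weight on \<open>s\<^sub>i\<close> costs \<open>1 - 2 s\<^sub>i\<close>, so weight is worth placing exactly
  where \<open>s\<^sub>i \<ge> 1/2\<close>, and if there is no such \<open>i\<close>, the unavoidable total weight 1 goes to the largest
  \<open>s\<^sub>0\<close> (\<open>weighted_sum_le_truncated\<close>, \<open>weighted_sum_le_top\<close>). The truncated decomposition attains this
  bound. It is admissible because it is a Parseval frame (\<open>truncated_svd_parseval\<close>) and because
  \<open>v\<^sub>0, \<dots>, v\<^sub>k\<^sub>-\<^sub>1\<close> belong to nonzero singular values and thus lie in the range of \<open>G\<close>, inside \<open>S\<close>
  (\<open>singular_vector_in_csubspace\<close>); some singular value is nonzero since the \<open>f\<^sub>j\<close> are not all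
  orthogonal to \<open>S\<close>.
\<close>

section \<open>Inner products and linear combinations\<close>

text \<open>
  The synthesis operator of a family. Indexing by \<open>j\<close> instead of by a set of vectors keeps
  repeated members of the family apart.
\<close>
definition lin_comb :: "nat \<Rightarrow> nat \<Rightarrow> (nat \<Rightarrow> complex) \<Rightarrow> (nat \<Rightarrow> complex vec) \<Rightarrow> complex vec" where
  "lin_comb m N c x = vec m (\<lambda>a. \<Sum>j<N. c j * x j $ a)"

lemma lin_comb_carrier [simp]: "lin_comb m N c x \<in> carrier_vec m"
  by (simp add: lin_comb_def)

lemma cinner_sum:
  assumes "y \<in> carrier_vec m"
  shows "x \<bullet>c y = (\<Sum>a<m. x $ a * cnj (y $ a))"
  using assms by (simp add: scalar_prod_def atLeast0LessThan)

lemma cinner_self: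
  assumes "x \<in> carrier_vec m"
  shows "x \<bullet>c x = complex_of_real ((cnorm x)\<^sup>2)" and cnorm_sq_sum: "(cnorm x)\<^sup>2 = (\<Sum>a<m. (cmod (x $ a))\<^sup>2)"
proof -
  have eq: "x \<bullet>c x = complex_of_real (\<Sum>a<m. (cmod (x $ a))\<^sup>2)"
    unfolding cinner_sum[OF assms] of_real_sum by (simp only: complex_norm_square[symmetric])
  have "0 \<le> (\<Sum>a<m. (cmod (x $ a))\<^sup>2)" by (simp add: sum_nonneg)
  then show "(cnorm x)\<^sup>2 = (\<Sum>a<m. (cmod (x $ a))\<^sup>2)"
    unfolding cnorm_def eq by simp
  with eq show "x \<bullet>c x = complex_of_real ((cnorm x)\<^sup>2)" by simp
qed

lemma cinner_commute:
  assumes "x \<in> carrier_vec m" "y \<in> carrier_vec m"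
  shows "y \<bullet>c x = cnj (x \<bullet>c y)"
  unfolding cinner_sum[OF assms(1)] cinner_sum[OF assms(2)] by (simp add: mult.commute)

lemma cinner_diff_left:
  fixes x y z :: "complex vec"
  assumes "x \<in> carrier_vec m" "y \<in> carrier_vec m" "z \<in> carrier_vec m"
  shows "(x - y) \<bullet>c z = x \<bullet>c z - y \<bullet>c z"
  unfolding cinner_sum[OF assms(3)] using assms
  by (simp add: sum_subtractf left_diff_distrib)

lemma cinner_lin_comb_left:
  assumes "y \<in> carrier_vec m"
  shows "lin_comb m N c x \<bullet>c y = (\<Sum>j<N. c j * (x j \<bullet>c y))"
proof -
  have "lin_comb m N c x \<bullet>c y = (\<Sum>a<m. \<Sum>j<N. c j * (x j $ a * cnj (y $ a)))"
    unfolding cinner_sum[OF assms] by (simp add: lin_comb_def sum_distrib_right mult.assoc)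
  also have "\<dots> = (\<Sum>j<N. c j * (x j \<bullet>c y))"
    unfolding cinner_sum[OF assms] sum_distrib_left by (rule sum.swap)
  finally show ?thesis .
qed

lemma cinner_lin_comb_right:
  assumes "v \<in> carrier_vec m" "\<And>j. j < N \<Longrightarrow> x j \<in> carrier_vec m"
  shows "v \<bullet>c lin_comb m N c x = (\<Sum>j<N. cnj (c j) * (v \<bullet>c x j))"
proof -
  have "v \<bullet>c lin_comb m N c x = cnj (lin_comb m N c x \<bullet>c v)"
    using assms(1) by (intro cinner_commute) auto
  also have "\<dots> = (\<Sum>j<N. cnj (c j) * cnj (x j \<bullet>c v))"
    by (simp add: cinner_lin_comb_left[OF assms(1)])
  also have "\<dots> = (\<Sum>j<N. cnj (c j) * (v \<bullet>c x j))"
    by (intro sum.cong refl arg_cong2[where f = "(*)"] cinner_commute[symmetric])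
       (use assms in auto)
  finally show ?thesis .
qed

lemma cnorm_diff_sq:
  assumes "x \<in> carrier_vec m" "y \<in> carrier_vec m"
  shows "(cnorm (x - y))\<^sup>2 = (cnorm x)\<^sup>2 - 2 * Re (x \<bullet>c y) + (cnorm y)\<^sup>2"
proof -
  have "(cmod (a - b))\<^sup>2 = (cmod a)\<^sup>2 - 2 * Re (a * cnj b) + (cmod b)\<^sup>2" for a b :: complex
    unfolding cmod_power2 by (simp add: power2_eq_square algebra_simps)
  then show ?thesis
    using assms by (simp add: cnorm_sq_sum[of _ m] cinner_sum[OF assms(2)] sum.distrib sum_subtractf
        sum_distrib_left)
qed

lemma cnorm_sq_eq_0_iff:
  assumes "x \<in> carrier_vec m"
  shows "(cnorm x)\<^sup>2 = 0 \<longleftrightarrow> x = 0\<^sub>v m"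
  using conjugate_square_eq_0_vec[OF assms] cinner_self(1)[OF assms] by simp

text \<open>
  From \<open>0 \<le> \<parallel>x - y\<parallel>\<^sup>2\<close>. This additive form of the Cauchy-Schwarz inequality is the one that suits
  the objective, because the two squares can afterwards be summed over a basis separately.
\<close>
lemma Re_cinner_le:
  assumes "x \<in> carrier_vec m" "y \<in> carrier_vec m"
  shows "Re (x \<bullet>c y) \<le> ((cnorm x)\<^sup>2 + (cnorm y)\<^sup>2) / 2"
proof -
  have "0 \<le> (cnorm x)\<^sup>2 - 2 * Re (x \<bullet>c y) + (cnorm y)\<^sup>2"
    unfolding cnorm_diff_sq[OF assms, symmetric] by simp
  then show ?thesis by argo
qed

section \<open>Orthonormal families\<close>

definition orthonormal :: "nat \<Rightarrow> nat \<Rightarrow> (nat \<Rightarrow> complex vec) \<Rightarrow> bool" where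
  "orthonormal m p q \<longleftrightarrow> (\<forall>i<p. q i \<in> carrier_vec m) \<and>
     (\<forall>i<p. \<forall>j<p. q i \<bullet>c q j = (if i = j then 1 else 0))"

lemma orthonormal_carrier: "orthonormal m p q \<Longrightarrow> i < p \<Longrightarrow> q i \<in> carrier_vec m"
  by (simp add: orthonormal_def)

lemma orthonormal_cinner:
  "orthonormal m p q \<Longrightarrow> i < p \<Longrightarrow> j < p \<Longrightarrow> q i \<bullet>c q j = (if i = j then 1 else 0)"
  by (simp add: orthonormal_def)

lemma cinner_orthonormal_lin_comb:
  assumes "orthonormal m p q" "j < p"
  shows "lin_comb m p c q \<bullet>c q j = c j"
proof -
  have "lin_comb m p c q \<bullet>c q j = (\<Sum>i<p. c i * (q i \<bullet>c q j))"
    by (intro cinner_lin_comb_left orthonormal_carrier[OF assms])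
  also have "\<dots> = (\<Sum>i<p. if i = j then c i else 0)"
    using assms by (intro sum.cong) (auto simp: orthonormal_def)
  finally show ?thesis using assms(2) by simp
qed

lemma cnorm_orthonormal_lin_comb:
  assumes "orthonormal m p q"
  shows "(cnorm (lin_comb m p c q))\<^sup>2 = (\<Sum>i<p. (cmod (c i))\<^sup>2)"
proof -
  have "complex_of_real ((cnorm (lin_comb m p c q))\<^sup>2) = lin_comb m p c q \<bullet>c lin_comb m p c q"
    by (rule cinner_self(1)[of _ m, symmetric]) simp
  also have "\<dots> = (\<Sum>i<p. cnj (c i) * (lin_comb m p c q \<bullet>c q i))"
    by (intro cinner_lin_comb_right) (auto simp: orthonormal_carrier[OF assms])
  also have "\<dots> = (\<Sum>i<p. complex_of_real ((cmod (c i))\<^sup>2))"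
    by (intro sum.cong refl)
       (simp add: cinner_orthonormal_lin_comb[OF assms] complex_norm_square[symmetric] mult.commute[of "cnj _"]
         del: of_real_power)
  finally show ?thesis by (simp only: of_real_sum[symmetric] of_real_eq_iff)
qed

text \<open>
  Pythagoras: the residual of \<open>x\<close> is orthogonal to the subtracted combination.
\<close>
lemma cnorm_residual:
  assumes q: "orthonormal m p q" and x: "x \<in> carrier_vec m"
  shows "(cnorm (x - lin_comb m p (\<lambda>i. x \<bullet>c q i) q))\<^sup>2 = (cnorm x)\<^sup>2 - (\<Sum>i<p. (cmod (x \<bullet>c q i))\<^sup>2)"
proof -
  have "x \<bullet>c lin_comb m p (\<lambda>i. x \<bullet>c q i) q = (\<Sum>i<p. cnj (x \<bullet>c q i) * (x \<bullet>c q i))"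
    by (intro cinner_lin_comb_right x) (auto simp: orthonormal_carrier[OF q])
  also have "\<dots> = (\<Sum>i<p. complex_of_real ((cmod (x \<bullet>c q i))\<^sup>2))"
    by (simp only: complex_norm_square mult.commute)
  finally have "Re (x \<bullet>c lin_comb m p (\<lambda>i. x \<bullet>c q i) q) = (\<Sum>i<p. (cmod (x \<bullet>c q i))\<^sup>2)"
    by (simp only: of_real_sum[symmetric] Re_complex_of_real)
  then show ?thesis
    by (simp add: cnorm_diff_sq[OF x] cnorm_orthonormal_lin_comb[OF q])
qed

lemma Bessel_inequality:
  assumes "orthonormal m p q" "x \<in> carrier_vec m"
  shows "(\<Sum>i<p. (cmod (x \<bullet>c q i))\<^sup>2) \<le> (cnorm x)\<^sup>2"
  using cnorm_residual[OF assms] zero_le_power2[of "cnorm (x - lin_comb m p (\<lambda>i. x \<bullet>c q i) q)"]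
  by linarith

text \<open>
  Bessel's inequality for the standard basis vectors bounds every row of the matrix with columns
  \<open>q\<^sub>i\<close> by 1; adding up the \<open>m\<close> rows counts the \<open>p\<close> unit columns.
\<close>
lemma orthonormal_le_dim:
  assumes q: "orthonormal m p q"
  shows "p \<le> m"
proof -
  have unit: "unit_vec m a \<bullet>c q i = cnj (q i $ a)" if "a < m" "i < p" for a i
    using orthonormal_carrier[OF q that(2)] that(1)
    by (subst scalar_prod_left_unit[of _ m]) auto
  have "(\<Sum>i<p. (cmod (q i $ a))\<^sup>2) \<le> 1" if a: "a < m" for a
  proof -
    have "(cnorm (unit_vec m a))\<^sup>2 = 1"
      unfolding cnorm_def using a by (simp add: scalar_prod_left_unit[of _ m])
    then show ?thesis
      using Bessel_inequality[OF q, of "unit_vec m a"] by (simp add: unit[OF a])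
  qed
  then have "(\<Sum>a<m. \<Sum>i<p. (cmod (q i $ a))\<^sup>2) \<le> (\<Sum>a<m. 1)"
    by (intro sum_mono) auto
  moreover have "(\<Sum>a<m. \<Sum>i<p. (cmod (q i $ a))\<^sup>2) = (\<Sum>i<p. (cnorm (q i))\<^sup>2)"
    by (subst sum.swap) (intro sum.cong refl, simp add: cnorm_sq_sum[OF orthonormal_carrier[OF q]])
  moreover have "(\<Sum>i<p. (cnorm (q i))\<^sup>2) = real p"
    using q by (simp add: cnorm_def orthonormal_def)
  ultimately show ?thesis by simp
qed

section \<open>Subspaces and orthogonal projections\<close>

lemma csubspace_iff:
  "csubspace m S \<longleftrightarrow> S \<subseteq> carrier_vec m \<and> 0\<^sub>v m \<in> S \<and> (\<forall>x\<in>S. \<forall>y\<in>S. x + y \<in> S) \<and>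
     (\<forall>c. \<forall>x\<in>S. c \<cdot>\<^sub>v x \<in> S)"
  unfolding csubspace_def VectorSpace.subspace_def submodule_def
  using vec_vs[where ?'a = complex, of m] vec_module[where ?'a = complex, of m]
  by (auto simp: module_vec_simps)

lemma lin_comb_in_csubspace:
  assumes S: "csubspace m S" and x: "\<And>j. j < N \<Longrightarrow> x j \<in> S"
  shows "lin_comb m N c x \<in> S"
  using x
proof (induction N)
  case 0
  have "lin_comb m 0 c x = 0\<^sub>v m" by (auto simp: lin_comb_def)
  then show ?case using S by (simp add: csubspace_iff)
next
  case (Suc N)
  have "x N \<in> carrier_vec m" using S Suc.prems[of N] by (auto simp: csubspace_iff)
  then have "lin_comb m (Suc N) c x = lin_comb m N c x + c N \<cdot>\<^sub>v x N"
    by (auto simp: lin_comb_def)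
  moreover have "lin_comb m N c x \<in> S" "c N \<cdot>\<^sub>v x N \<in> S"
    using S Suc by (auto simp: csubspace_iff)
  ultimately show ?case using S by (auto simp: csubspace_iff)
qed

lemma csubspace_orth_compl:
  assumes "S \<subseteq> carrier_vec m"
  shows "csubspace m (orth_compl m S)"
proof -
  have "(x + y) \<bullet>c z = x \<bullet>c z + y \<bullet>c z" "(c \<cdot>\<^sub>v x) \<bullet>c z = c * (x \<bullet>c z)"
    if "x \<in> carrier_vec m" "y \<in> carrier_vec m" "z \<in> S" for x y z c
    using that assms by (auto intro!: add_scalar_prod_distrib[of _ m])
  then show ?thesis
    using assms unfolding csubspace_iff orth_compl_def by (auto simp: subset_iff)
qed

lemma cspan_least:
  assumes "csubspace m T" "A \<subseteq> T"
  shows "cspan m A \<subseteq> T"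
  using module.span_is_subset[OF vec_module assms(2)] assms(1)
  unfolding cspan_def csubspace_def VectorSpace.subspace_def by blast

lemma cspan_superset:
  assumes "A \<subseteq> carrier_vec m"
  shows "A \<subseteq> cspan m A"
  unfolding cspan_def using module.in_own_span[OF vec_module, of A m] assms
  by (simp add: module_vec_simps)

lemma csubspace_cspan:
  assumes "A \<subseteq> carrier_vec m"
  shows "csubspace m (cspan m A)"
  unfolding cspan_def csubspace_def using vectorspace.span_is_subspace[OF vec_vs, of A m] assms
  by (simp add: module_vec_simps)

text \<open>
  An orthonormal family in \<open>S\<close> of maximal length, which exists because lengths are bounded by
  \<open>m\<close>, spans \<open>S\<close>: the normalised residual of a vector outside its span would prolong it.
\<close>
lemma orthonormal_basis_exists:
  assumes S: "csubspace m S"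
  obtains p q where "orthonormal m p q" "\<And>i. i < p \<Longrightarrow> q i \<in> S"
    "\<And>y. y \<in> S \<Longrightarrow> y = lin_comb m p (\<lambda>i. y \<bullet>c q i) q"
proof -
  let ?P = "\<lambda>p. \<exists>q. orthonormal m p q \<and> (\<forall>i<p. q i \<in> S)"
  have P0: "?P 0" by (auto simp: orthonormal_def)
  have bound: "\<And>p. ?P p \<Longrightarrow> p \<le> m" using orthonormal_le_dim by blast
  define p where "p = (GREATEST p. ?P p)"
  have "?P p" unfolding p_def by (rule GreatestI_nat[of ?P 0 m, OF P0 bound])
  then obtain q where q: "orthonormal m p q" and qS: "\<And>i. i < p \<Longrightarrow> q i \<in> S" by blast
  \<comment> \<open>\<open>e\<close> below would extend \<open>q\<close> and contradict this maximality.\<close>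
  have max: "\<not> ?P (Suc p)"
    using Greatest_le_nat[of ?P "Suc p" m, OF _ bound] unfolding p_def by fastforce
  have "y = lin_comb m p (\<lambda>i. y \<bullet>c q i) q" if y: "y \<in> S" for y
  proof (rule ccontr)
    assume neq: "y \<noteq> lin_comb m p (\<lambda>i. y \<bullet>c q i) q"
    let ?l = "lin_comb m p (\<lambda>i. y \<bullet>c q i) q"
    define z where "z = y - ?l"
    have yc: "y \<in> carrier_vec m" using y S by (auto simp: csubspace_iff)
    have lS: "?l \<in> S" by (rule lin_comb_in_csubspace[OF S qS])
    have z_alt: "z = y + (-1) \<cdot>\<^sub>v ?l" using yc by (auto simp: z_def)
    have zS: "z \<in> S" unfolding z_alt using S y lS by (auto simp: csubspace_iff)
    then have zc: "z \<in> carrier_vec m" using S by (auto simp: csubspace_iff)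
    have z0: "z \<noteq> 0\<^sub>v m"
    proof
      assume "z = 0\<^sub>v m"
      then have "z $ a = 0" if "a < m" for a using that by simp
      then have "y = ?l" using yc by (intro eq_vecI) (auto simp: z_def lin_comb_def)
      with neq show False by simp
    qed
    define t where "t = cnorm z"
    have t0: "t \<noteq> 0" using z0 cnorm_sq_eq_0_iff[OF zc] by (auto simp: t_def)
    define e where "e = complex_of_real (1 / t) \<cdot>\<^sub>v z"
    have eS: "e \<in> S" using zS S by (auto simp: e_def csubspace_iff)
    have ec: "e \<in> carrier_vec m" using zc by (simp add: e_def)
    have zq: "z \<bullet>c q i = 0" if "i < p" for i
      unfolding z_def using cinner_diff_left[OF yc _ orthonormal_carrier[OF q that], of ?l] that
      by (simp add: cinner_orthonormal_lin_comb[OF q])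
    have eq0: "e \<bullet>c q i = 0" if "i < p" for i
      using zq[OF that] zc orthonormal_carrier[OF q that] by (simp add: e_def)
    have qe0: "q i \<bullet>c e = 0" if "i < p" for i
      using cinner_commute[OF ec orthonormal_carrier[OF q that]] eq0[OF that] by simp
    have ee: "e \<bullet>c e = 1"
    proof -
      have "e \<bullet>c e = complex_of_real (1 / t) * cnj (complex_of_real (1 / t)) * (z \<bullet>c z)"
        using zc by (simp add: e_def conjugate_smult_vec)
      then show ?thesis
        using t0 by (simp add: cinner_self(1)[OF zc] t_def[symmetric] power2_eq_square)
    qed
    have "orthonormal m (Suc p) (q(p := e))"
      using q ec eq0 qe0 ee by (auto simp: orthonormal_def less_Suc_eq)
    moreover have "\<forall>i<Suc p. (q(p := e)) i \<in> S" using qS eS by (auto simp: less_Suc_eq)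
    ultimately show False using max by blast
  qed
  with q qS that show ?thesis by blast
qed

text \<open>
  The difference of two candidates \<open>P x\<close> and \<open>Q x\<close> lies in \<open>S\<close> and is orthogonal to \<open>S\<close>.
\<close>
lemma orth_proj_unique:
  assumes S: "csubspace m S"
    and P: "P \<in> carrier_mat m m"
      "\<forall>x\<in>carrier_vec m. P *\<^sub>v x \<in> S \<and> x - P *\<^sub>v x \<in> orth_compl m S"
    and Q: "Q \<in> carrier_mat m m"
      "\<forall>x\<in>carrier_vec m. Q *\<^sub>v x \<in> S \<and> x - Q *\<^sub>v x \<in> orth_compl m S"
  shows "P = Q"
proof (rule eq_matI)
  fix a b assume "a < dim_row Q" "b < dim_col Q"
  then have ab: "a < m" "b < m" using Q by auto
  define x where "x = (unit_vec m b :: complex vec)"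
  have xc: "x \<in> carrier_vec m" by (simp add: x_def)
  define d where "d = P *\<^sub>v x - Q *\<^sub>v x"
  have Pc: "P *\<^sub>v x \<in> carrier_vec m" and Qc: "Q *\<^sub>v x \<in> carrier_vec m" using P(1) Q(1) xc by auto
  have d_alt: "d = P *\<^sub>v x + (-1) \<cdot>\<^sub>v (Q *\<^sub>v x)" using Pc Qc by (auto simp: d_def)
  have dS: "d \<in> S" using S P(2) Q(2) xc unfolding d_alt by (auto simp: csubspace_iff)
  have dc: "d \<in> carrier_vec m" using Pc Qc by (simp add: d_def)
  have "(x - P *\<^sub>v x) \<bullet>c d = 0" "(x - Q *\<^sub>v x) \<bullet>c d = 0"
    using P(2) Q(2) xc dS by (auto simp: orth_compl_def)
  then have "d \<bullet>c d = 0"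
    unfolding cinner_diff_left[OF xc Pc dc] cinner_diff_left[OF xc Qc dc]
    using cinner_diff_left[OF Pc Qc dc] by (simp add: d_def[symmetric])
  then have "d = 0\<^sub>v m" using dc by simp
  then have "d $ a = 0" using ab by simp
  then have "(P *\<^sub>v x) $ a = (Q *\<^sub>v x) $ a" using ab P(1) Q(1) by (simp add: d_def)
  then show "P $$ (a, b) = Q $$ (a, b)"
    using ab P(1) Q(1) by (simp add: x_def)
qed (use P(1) Q(1) in auto)

text \<open>
  The matrix \<open>\<Sum>\<^sub>i q\<^sub>i q\<^sub>i\<^sup>*\<close> of an orthonormal basis of \<open>S\<close> satisfies the defining property, and by
  uniqueness it is the matrix that the definite description denotes.
\<close>
lemma orth_proj_properties:
  assumes S: "csubspace m S"
  shows "orth_proj m S \<in> carrier_mat m m \<and>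
     (\<forall>x\<in>carrier_vec m. orth_proj m S *\<^sub>v x \<in> S \<and> x - orth_proj m S *\<^sub>v x \<in> orth_compl m S)"
proof -
  obtain p q where q: "orthonormal m p q" and qS: "\<And>i. i < p \<Longrightarrow> q i \<in> S"
    and exp: "\<And>y. y \<in> S \<Longrightarrow> y = lin_comb m p (\<lambda>i. y \<bullet>c q i) q"
    by (rule orthonormal_basis_exists[OF S]) blast
  define P where "P = mat m m (\<lambda>(a, b). \<Sum>i<p. q i $ a * cnj (q i $ b))"
  have Px: "P *\<^sub>v x = lin_comb m p (\<lambda>i. x \<bullet>c q i) q" if x: "x \<in> carrier_vec m" for x
  proof (rule eq_vecI)
    fix a assume "a < dim_vec (lin_comb m p (\<lambda>i. x \<bullet>c q i) q)"
    then have a: "a < m" by (simp add: lin_comb_def)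
    have "(P *\<^sub>v x) $ a = (\<Sum>b<m. \<Sum>i<p. q i $ a * cnj (q i $ b) * x $ b)"
      using a x by (simp add: P_def scalar_prod_def sum_distrib_right atLeast0LessThan)
    also have "\<dots> = (\<Sum>i<p. \<Sum>b<m. q i $ a * cnj (q i $ b) * x $ b)" by (rule sum.swap)
    also have "\<dots> = (\<Sum>i<p. (x \<bullet>c q i) * q i $ a)"
      by (intro sum.cong refl)
         (simp add: cinner_sum[OF orthonormal_carrier[OF q]] sum_distrib_right sum_distrib_left ac_simps)
    finally show "(P *\<^sub>v x) $ a = lin_comb m p (\<lambda>i. x \<bullet>c q i) q $ a"
      using a by (simp add: lin_comb_def)
  qed (simp add: P_def lin_comb_def)
  have P: "P \<in> carrier_mat m m \<and> (\<forall>x\<in>carrier_vec m. P *\<^sub>v x \<in> S \<and> x - P *\<^sub>v x \<in> orth_compl m S)"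
  proof (intro conjI ballI)
    show "P \<in> carrier_mat m m" by (simp add: P_def)
    fix x :: "complex vec" assume x: "x \<in> carrier_vec m"
    show "P *\<^sub>v x \<in> S" unfolding Px[OF x] by (rule lin_comb_in_csubspace[OF S qS])
    let ?l = "lin_comb m p (\<lambda>i. x \<bullet>c q i) q"
    have "(x - ?l) \<bullet>c y = 0" if y: "y \<in> S" for y
    proof -
      have "(x - ?l) \<bullet>c q i = 0" if "i < p" for i
        using cinner_diff_left[OF x _ orthonormal_carrier[OF q that], of ?l] that
        by (simp add: cinner_orthonormal_lin_comb[OF q])
      moreover have "(x - ?l) \<bullet>c lin_comb m p (\<lambda>i. y \<bullet>c q i) q
          = (\<Sum>i<p. cnj (y \<bullet>c q i) * ((x - ?l) \<bullet>c q i))"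
        by (rule cinner_lin_comb_right) (use x orthonormal_carrier[OF q] in auto)
      ultimately have "(x - ?l) \<bullet>c lin_comb m p (\<lambda>i. y \<bullet>c q i) q = 0" by simp
      then show ?thesis using exp[OF y] by simp
    qed
    then show "x - P *\<^sub>v x \<in> orth_compl m S"
      unfolding Px[OF x] using x by (auto simp: orth_compl_def)
  qed
  show ?thesis unfolding orth_proj_def
    by (rule theI[where a = P]) (use P orth_proj_unique[OF S] in blast)+
qed

lemma orth_proj_carrier [simp]:
  "csubspace m S \<Longrightarrow> orth_proj m S \<in> carrier_mat m m"
  using orth_proj_properties by blast

lemma orth_proj_in:
  "csubspace m S \<Longrightarrow> x \<in> carrier_vec m \<Longrightarrow> orth_proj m S *\<^sub>v x \<in> S"
  using orth_proj_properties by blast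

lemma cinner_orth_proj:
  assumes S: "csubspace m S" and x: "x \<in> carrier_vec m" and y: "y \<in> S"
  shows "(orth_proj m S *\<^sub>v x) \<bullet>c y = x \<bullet>c y"
proof -
  have "(x - orth_proj m S *\<^sub>v x) \<bullet>c y = 0"
    using orth_proj_properties[OF S] x y by (auto simp: orth_compl_def)
  moreover have "y \<in> carrier_vec m" "orth_proj m S *\<^sub>v x \<in> carrier_vec m"
    using S y orth_proj_in[OF S x] by (auto simp: csubspace_iff)
  ultimately show ?thesis using cinner_diff_left[OF x] by simp
qed

lemma in_csubspace_if_orth_compl:
  assumes S: "csubspace m S" and x: "x \<in> carrier_vec m"
    and orth: "\<And>y. y \<in> orth_compl m S \<Longrightarrow> x \<bullet>c y = 0"
  shows "x \<in> S"
proof -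
  let ?px = "orth_proj m S *\<^sub>v x"
  have pS: "?px \<in> S" by (rule orth_proj_in[OF S x])
  then have pc: "?px \<in> carrier_vec m" using S by (auto simp: csubspace_iff)
  have d: "x - ?px \<in> orth_compl m S" using orth_proj_properties[OF S] x by blast
  have dc: "x - ?px \<in> carrier_vec m" using x pc by simp
  have "(x - ?px) \<bullet>c ?px = 0" using d pS by (simp add: orth_compl_def)
  then have "?px \<bullet>c (x - ?px) = 0" using cinner_commute[OF dc pc] by simp
  then have "(x - ?px) \<bullet>c (x - ?px) = 0"
    using cinner_diff_left[OF x pc dc] orth[OF d] by simp
  then have z: "x - ?px = 0\<^sub>v m" using dc by simp
  have "x = ?px"
  proof (rule eq_vecI)
    fix a assume "a < dim_vec ?px"
    then have a: "a < m" using carrier_vecD[OF pc] by argo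
    have "(x - ?px) $ a = 0" using z a by simp
    then show "x $ a = ?px $ a" using a x orth_proj_properties[OF S] by auto
  qed (use x orth_proj_properties[OF S] in auto)
  with pS show ?thesis by simp
qed

lemma cnorm_orth_proj_le:
  assumes S: "csubspace m S" and x: "x \<in> carrier_vec m"
  shows "(cnorm (orth_proj m S *\<^sub>v x))\<^sup>2 \<le> (cnorm x)\<^sup>2"
proof -
  let ?px = "orth_proj m S *\<^sub>v x"
  have pS: "?px \<in> S" by (rule orth_proj_in[OF S x])
  then have pc: "?px \<in> carrier_vec m" using S by (auto simp: csubspace_iff)
  have "x \<bullet>c ?px = ?px \<bullet>c ?px" using cinner_orth_proj[OF S x pS] by simp
  then have "Re (x \<bullet>c ?px) = (cnorm ?px)\<^sup>2" by (simp add: cinner_self(1)[OF pc])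
  with Re_cinner_le[OF x pc] show ?thesis by argo
qed

section \<open>Parseval frames\<close>

lemma parseval_frame_forD:
  assumes "parseval_frame_for m n x K"
  shows "csubspace m K" "j < n \<Longrightarrow> x j \<in> K" "j < n \<Longrightarrow> x j \<in> carrier_vec m"
    "g \<in> K \<Longrightarrow> (\<Sum>j<n. (cmod (g \<bullet>c x j))\<^sup>2) = (cnorm g)\<^sup>2"
proof -
  have fr: "frame_for m n x K" using assms by (simp add: parseval_frame_for_def)
  then show "csubspace m K" by (simp add: frame_for_def)
  have "x ` {..<n} \<subseteq> carrier_vec m" using fr by (auto simp: frame_for_def)
  from cspan_superset[OF this] show "j < n \<Longrightarrow> x j \<in> K" using fr by (auto simp: frame_for_def)
  show "j < n \<Longrightarrow> x j \<in> carrier_vec m" using fr by (auto simp: frame_for_def)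
  show "g \<in> K \<Longrightarrow> (\<Sum>j<n. (cmod (g \<bullet>c x j))\<^sup>2) = (cnorm g)\<^sup>2"
    using assms by (simp add: parseval_frame_for_def)
qed

text \<open>
  Frame vectors do not see the component of \<open>v\<close> orthogonal to \<open>K\<close>, and on \<open>K\<close> the Parseval
  identity applies. Hence the analysis operator is a contraction on the whole space.
\<close>
lemma parseval_analysis:
  assumes x: "parseval_frame_for m n x K" and v: "v \<in> carrier_vec m"
  shows "(\<Sum>j<n. (cmod (v \<bullet>c x j))\<^sup>2) = (cnorm (orth_proj m K *\<^sub>v v))\<^sup>2"
proof -
  note K = parseval_frame_forD[OF x]
  have "(\<Sum>j<n. (cmod (v \<bullet>c x j))\<^sup>2) = (\<Sum>j<n. (cmod ((orth_proj m K *\<^sub>v v) \<bullet>c x j))\<^sup>2)"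
    by (intro sum.cong) (auto simp: cinner_orth_proj[OF K(1) v] K(2))
  also have "\<dots> = (cnorm (orth_proj m K *\<^sub>v v))\<^sup>2"
    by (intro K(4) orth_proj_in[OF K(1) v])
  finally show ?thesis .
qed

lemma parseval_analysis_le:
  assumes "parseval_frame_for m n x K" "v \<in> carrier_vec m"
  shows "(\<Sum>j<n. (cmod (v \<bullet>c x j))\<^sup>2) \<le> (cnorm v)\<^sup>2"
  unfolding parseval_analysis[OF assms]
  by (rule cnorm_orth_proj_le[OF parseval_frame_forD(1)[OF assms(1)] assms(2)])

text \<open>
  With \<open>g = \<Sum>\<^sub>j c\<^sub>j x\<^sub>j \<in> K\<close> one has \<open>\<parallel>g\<parallel>\<^sup>2 = \<Sum>\<^sub>j cnj c\<^sub>j \<langle>g, x\<^sub>j\<rangle> \<le> (\<parallel>c\<parallel>\<^sup>2 + \<parallel>g\<parallel>\<^sup>2) / 2\<close>, because the Parseval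
  identity evaluates \<open>\<Sum>\<^sub>j \<bar>\<langle>g, x\<^sub>j\<rangle>\<bar>\<^sup>2\<close>.
\<close>
lemma parseval_synthesis_le:
  assumes x: "parseval_frame_for m n x K"
  shows "(cnorm (lin_comb m n c x))\<^sup>2 \<le> (\<Sum>j<n. (cmod (c j))\<^sup>2)"
proof -
  note K = parseval_frame_forD[OF x]
  let ?g = "lin_comb m n c x"
  have gK: "?g \<in> K" by (rule lin_comb_in_csubspace[OF K(1) K(2)])
  have "Re (?g \<bullet>c ?g) = (\<Sum>j<n. Re (cnj (c j) * (?g \<bullet>c x j)))"
    by (subst cinner_lin_comb_right) (auto simp: K(3))
  also have "\<dots> \<le> (\<Sum>j<n. ((cmod (c j))\<^sup>2 + (cmod (?g \<bullet>c x j))\<^sup>2) / 2)"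
  proof (intro sum_mono)
    fix j
    have "Re (cnj (c j) * (?g \<bullet>c x j)) \<le> cmod (c j) * cmod (?g \<bullet>c x j)"
      using complex_Re_le_cmod[of "cnj (c j) * (?g \<bullet>c x j)"] by (simp add: norm_mult)
    also have "\<dots> \<le> ((cmod (c j))\<^sup>2 + (cmod (?g \<bullet>c x j))\<^sup>2) / 2"
      using sum_squares_bound[of "cmod (c j)" "cmod (?g \<bullet>c x j)"] by simp
    finally show "Re (cnj (c j) * (?g \<bullet>c x j)) \<le> ((cmod (c j))\<^sup>2 + (cmod (?g \<bullet>c x j))\<^sup>2) / 2" .
  qed
  also have "\<dots> = ((\<Sum>j<n. (cmod (c j))\<^sup>2) + (cnorm ?g)\<^sup>2) / 2"
    unfolding sum_divide_distrib[symmetric] sum.distrib K(4)[OF gK] ..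
  finally show ?thesis by (simp add: cinner_self(1)[of _ m])
qed

text \<open>
  The left side only depends on the projection of \<open>v\<close> to \<open>K\<close>, whose squared norm is the first sum
  on the right. Keeping that sum instead of the larger \<open>\<parallel>v\<parallel>\<^sup>2\<close> pays off when \<open>v\<close> runs through an
  orthonormal basis: the sums then add up to \<open>\<Sum>\<^sub>j \<parallel>x\<^sub>j\<parallel>\<^sup>2\<close>.
\<close>
lemma parseval_synthesis_cinner_le:
  assumes x: "parseval_frame_for m n x K" and v: "v \<in> carrier_vec m"
  shows "Re (v \<bullet>c lin_comb m n c x) \<le>
    ((\<Sum>j<n. (cmod (v \<bullet>c x j))\<^sup>2) + (cnorm (lin_comb m n c x))\<^sup>2) / 2"
proof -
  note K = parseval_frame_forD[OF x]
  have gK: "lin_comb m n c x \<in> K" by (rule lin_comb_in_csubspace[OF K(1) K(2)])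
  have "orth_proj m K *\<^sub>v v \<in> carrier_vec m"
    using orth_proj_in[OF K(1) v] K(1) by (auto simp: csubspace_iff)
  from Re_cinner_le[OF this, of "lin_comb m n c x"] show ?thesis
    by (simp add: cinner_orth_proj[OF K(1) v gK] parseval_analysis[OF x v])
qed

text \<open>
  The sum is the rank of the frame. To see that it is at least 1 it suffices to test the Parseval
  identity on one unit vector of \<open>K\<close> and to apply Bessel's inequality to each \<open>x\<^sub>j\<close>.
\<close>
lemma parseval_norm_ge_1:
  assumes x: "parseval_frame_for m n x K" and K0: "K \<noteq> {0\<^sub>v m}"
  shows "1 \<le> (\<Sum>j<n. (cnorm (x j))\<^sup>2)"
proof -
  note K = parseval_frame_forD[OF x]
  obtain p q where q: "orthonormal m p q" and qK: "\<And>i. i < p \<Longrightarrow> q i \<in> K"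
    and exp: "\<And>y. y \<in> K \<Longrightarrow> y = lin_comb m p (\<lambda>i. y \<bullet>c q i) q"
    by (rule orthonormal_basis_exists[OF K(1)]) blast
  have "p \<noteq> 0"
  proof
    assume p: "p = 0"
    have "lin_comb m 0 c q = 0\<^sub>v m" for c by (auto simp: lin_comb_def)
    with exp p have "\<And>y. y \<in> K \<Longrightarrow> y = 0\<^sub>v m" by metis
    moreover have "0\<^sub>v m \<in> K" using K(1) by (simp add: csubspace_iff)
    ultimately show False using K0 by blast
  qed
  then have p: "0 < p" by simp
  have q1: "orthonormal m 1 q" using q p by (simp add: orthonormal_def)
  have qc: "q 0 \<in> carrier_vec m" by (rule orthonormal_carrier[OF q p])
  have "1 = (cnorm (q 0))\<^sup>2" using orthonormal_cinner[OF q p p] by (simp add: cnorm_def)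
  also have "\<dots> = (\<Sum>j<n. (cmod (q 0 \<bullet>c x j))\<^sup>2)" using K(4)[OF qK[OF p]] by simp
  also have "\<dots> \<le> (\<Sum>j<n. (cnorm (x j))\<^sup>2)"
  proof (intro sum_mono)
    fix j assume "j \<in> {..<n}"
    then have xc: "x j \<in> carrier_vec m" using K(3) by simp
    have "(cmod (q 0 \<bullet>c x j))\<^sup>2 = (cmod (x j \<bullet>c q 0))\<^sup>2"
      by (simp add: cinner_commute[OF xc qc])
    also have "\<dots> \<le> (cnorm (x j))\<^sup>2" using Bessel_inequality[OF q1 xc] by simp
    finally show "(cmod (q 0 \<bullet>c x j))\<^sup>2 \<le> (cnorm (x j))\<^sup>2" .
  qed
  finally show ?thesis .
qed

section \<open>Unitary matrices and singular value decompositions\<close>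

lemma mat_adjoint_index [simp]:
  fixes A :: "complex mat"
  shows "i < dim_col A \<Longrightarrow> j < dim_row A \<Longrightarrow> mat_adjoint A $$ (i, j) = cnj (A $$ (j, i))"
    and "dim_row (mat_adjoint A) = dim_col A" "dim_col (mat_adjoint A) = dim_row A"
  by (simp_all add: mat_adjoint_def mat_of_rows_def)

lemma unitary_cols_orthonormal:
  assumes "unitary_mat n U"
  shows "orthonormal n n (col U)"
proof -
  have U: "U \<in> carrier_mat n n" and UU: "mat_adjoint U * U = 1\<^sub>m n"
    using assms by (auto simp: unitary_mat_def)
  have "col U i \<bullet>c col U j = (if i = j then 1 else 0)" if ij: "i < n" "j < n" for i j
  proof -
    have "col U i \<bullet>c col U j = (mat_adjoint U * U) $$ (j, i)"
      using U ij by (simp add: scalar_prod_def mult.commute)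
    then show ?thesis using ij by (simp add: UU)
  qed
  then show ?thesis using U by (auto simp: orthonormal_def)
qed

lemma unitary_rows_orthonormal:
  assumes "unitary_mat n U" "a < n" "b < n"
  shows "(\<Sum>i<n. U $$ (a, i) * cnj (U $$ (b, i))) = (if a = b then 1 else 0)"
proof -
  have U: "U \<in> carrier_mat n n" and UU: "U * mat_adjoint U = 1\<^sub>m n"
    using assms by (auto simp: unitary_mat_def)
  have "(\<Sum>i<n. U $$ (a, i) * cnj (U $$ (b, i))) = (U * mat_adjoint U) $$ (a, b)"
    using U assms(2,3) by (simp add: scalar_prod_def atLeast0LessThan)
  then show ?thesis using assms(2,3) by (simp add: UU)
qed

lemma unitary_expansion:
  assumes U: "unitary_mat n U" and x: "x \<in> carrier_vec n"
  shows "x = lin_comb n n (\<lambda>i. x \<bullet>c col U i) (col U)"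
proof (rule eq_vecI)
  have Uc: "U \<in> carrier_mat n n" using U by (auto simp: unitary_mat_def)
  fix a assume "a < dim_vec (lin_comb n n (\<lambda>i. x \<bullet>c col U i) (col U))"
  then have a: "a < n" by (simp add: lin_comb_def)
  have "lin_comb n n (\<lambda>i. x \<bullet>c col U i) (col U) $ a
      = (\<Sum>i<n. (\<Sum>b<n. x $ b * cnj (U $$ (b, i))) * U $$ (a, i))"
    using a Uc by (simp add: lin_comb_def cinner_sum[of _ n])
  also have "\<dots> = (\<Sum>i<n. \<Sum>b<n. x $ b * (U $$ (a, i) * cnj (U $$ (b, i))))"
    by (simp add: sum_distrib_right sum_distrib_left ac_simps)
  also have "\<dots> = (\<Sum>b<n. \<Sum>i<n. x $ b * (U $$ (a, i) * cnj (U $$ (b, i))))" by (rule sum.swap)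
  also have "\<dots> = (\<Sum>b<n. x $ b * (if a = b then 1 else 0))"
    unfolding sum_distrib_left[symmetric]
    by (intro sum.cong refl) (simp add: unitary_rows_orthonormal[OF U a])
  also have "\<dots> = (\<Sum>b<n. if a = b then x $ b else 0)"
    by (intro sum.cong refl) simp
  also have "\<dots> = x $ a" using a by simp
  finally show "x $ a = lin_comb n n (\<lambda>i. x \<bullet>c col U i) (col U) $ a" by simp
qed (use x in \<open>simp add: lin_comb_def\<close>)

lemma unitary_Parseval:
  assumes U: "unitary_mat n U" and x: "x \<in> carrier_vec n"
  shows "(\<Sum>i<n. (cmod (x \<bullet>c col U i))\<^sup>2) = (cnorm x)\<^sup>2"
  using cnorm_orthonormal_lin_comb[OF unitary_cols_orthonormal[OF U], of "\<lambda>i. x \<bullet>c col U i"]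
    unitary_expansion[OF U x] by simp

text \<open>
  Invariance of the Frobenius norm under multiplication by a unitary matrix from the right, which is
  the Parseval identity applied to the conjugate of each row.
\<close>
lemma sum_cnorm_synthesis_unitary:
  assumes W: "unitary_mat n W" and x: "\<And>j. j < n \<Longrightarrow> x j \<in> carrier_vec m"
  shows "(\<Sum>i<n. (cnorm (lin_comb m n (\<lambda>j. W $$ (j, i)) x))\<^sup>2) = (\<Sum>j<n. (cnorm (x j))\<^sup>2)"
proof -
  have Wc: "W \<in> carrier_mat n n" using W by (auto simp: unitary_mat_def)
  have row: "(\<Sum>i<n. (cmod (\<Sum>j<n. W $$ (j, i) * x j $ a))\<^sup>2) = (\<Sum>j<n. (cmod (x j $ a))\<^sup>2)" for a
  proof -
    define y where "y = vec n (\<lambda>j. cnj (x j $ a))"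
    have yc: "y \<in> carrier_vec n" by (simp add: y_def)
    have "cmod (\<Sum>j<n. W $$ (j, i) * x j $ a) = cmod (y \<bullet>c col W i)" if i: "i < n" for i
    proof -
      have "y \<bullet>c col W i = cnj (\<Sum>j<n. W $$ (j, i) * x j $ a)"
        using i Wc by (subst cinner_sum[of _ n]) (auto simp: y_def mult.commute)
      then show ?thesis by (simp only: complex_mod_cnj)
    qed
    then have "(\<Sum>i<n. (cmod (\<Sum>j<n. W $$ (j, i) * x j $ a))\<^sup>2) = (cnorm y)\<^sup>2"
      using unitary_Parseval[OF W yc] by simp
    also have "\<dots> = (\<Sum>j<n. (cmod (x j $ a))\<^sup>2)"
      unfolding cnorm_sq_sum[OF yc] by (simp add: y_def)
    finally show ?thesis .
  qed
  have "(\<Sum>i<n. (cnorm (lin_comb m n (\<lambda>j. W $$ (j, i)) x))\<^sup>2)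
      = (\<Sum>i<n. \<Sum>a<m. (cmod (\<Sum>j<n. W $$ (j, i) * x j $ a))\<^sup>2)"
    by (simp add: cnorm_sq_sum[of _ m]) (simp add: lin_comb_def)
  also have "\<dots> = (\<Sum>a<m. \<Sum>j<n. (cmod (x j $ a))\<^sup>2)"
    by (subst sum.swap) (simp add: row)
  also have "\<dots> = (\<Sum>j<n. (cnorm (x j))\<^sup>2)"
    by (subst sum.swap) (intro sum.cong refl, simp add: cnorm_sq_sum[OF x])
  finally show ?thesis .
qed

lemma embed_block_diag:
  assumes "r \<le> m" "r \<le> n"
  shows "embed_block m n r (mat_diag r d) = mat m n (\<lambda>(i, j). if i = j \<and> j < r then d j else 0)"
  using assms by (intro eq_matI) (auto simp: embed_block_def mat_diag_def)

text \<open>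
  The form in which a singular value decomposition enters everything below: with columns
  \<open>v\<^sub>i\<close> of \<open>V\<close>, each column of the product is a combination of \<open>v\<^sub>0, \<dots>, v\<^sub>r\<^sub>-\<^sub>1\<close>. It covers both \<open>G\<close>
  itself and, with all \<open>d i = 1\<close>, its truncation.
\<close>
lemma col_svd_product:
  assumes V: "V \<in> carrier_mat m m" and W: "W \<in> carrier_mat n n" and r: "r \<le> m" "r \<le> n" and j: "j < n"
  shows "col (V * embed_block m n r (mat_diag r d) * mat_adjoint W) j
    = lin_comb m r (\<lambda>i. d i * cnj (W $$ (j, i))) (col V)"
proof (rule eq_vecI)
  fix a assume "a < dim_vec (lin_comb m r (\<lambda>i. d i * cnj (W $$ (j, i))) (col V))"
  then have a: "a < m" by (simp add: lin_comb_def)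
  let ?E = "mat m n (\<lambda>(i, j). if i = j \<and> j < r then d j else 0)"
  have VE: "(V * ?E) $$ (a, i) = (if i < r then V $$ (a, i) * d i else 0)" if i: "i < n" for i
  proof -
    have "(V * ?E) $$ (a, i) = (\<Sum>l<m. V $$ (a, l) * (if l = i \<and> i < r then d i else 0))"
      using a i V by (simp add: scalar_prod_def atLeast0LessThan)
    also have "\<dots> = (\<Sum>l<m. if l = i then (if i < r then V $$ (a, i) * d i else 0) else 0)"
      by (intro sum.cong) auto
    also have "\<dots> = (if i < r then V $$ (a, i) * d i else 0)" using r by auto
    finally show ?thesis .
  qed
  have "(A * mat_adjoint W) $$ (a, j) = (\<Sum>i<n. A $$ (a, i) * cnj (W $$ (j, i)))"
    if "A \<in> carrier_mat m n" for A
    using a j W that by (simp add: scalar_prod_def atLeast0LessThan)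
  then have "(V * ?E * mat_adjoint W) $$ (a, j) = (\<Sum>i<n. (V * ?E) $$ (a, i) * cnj (W $$ (j, i)))"
    using V by (auto intro!: carrier_matI simp del: index_mult_mat(1))
  also have "\<dots> = (\<Sum>i<n. if i < r then V $$ (a, i) * d i * cnj (W $$ (j, i)) else 0)"
    by (intro sum.cong refl) (simp add: VE del: index_mult_mat(1))
  also have "\<dots> = (\<Sum>i<r. V $$ (a, i) * d i * cnj (W $$ (j, i)))"
    using r by (intro sum.mono_neutral_cong_right) auto
  also have "\<dots> = lin_comb m r (\<lambda>i. d i * cnj (W $$ (j, i))) (col V) $ a"
    using a V r by (simp add: lin_comb_def ac_simps)
  finally show "col (V * embed_block m n r (mat_diag r d) * mat_adjoint W) j $ a
      = lin_comb m r (\<lambda>i. d i * cnj (W $$ (j, i))) (col V) $ a"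
    unfolding embed_block_diag[OF r] using a j V W by simp
qed (use V in \<open>simp add: lin_comb_def\<close>)

lemma rank_le_dims:
  fixes G :: "complex mat"
  assumes "G \<in> carrier_mat m n"
  shows "vec_space.rank m G \<le> m" "vec_space.rank m G \<le> n"
proof -
  interpret vec_space "TYPE(complex)" m .
  show "vec_space.rank m G \<le> n" by (rule rank_le_nc[OF assms])
  obtain T where T: "maximal T (\<lambda>T. T \<subseteq> set (cols G) \<and> lin_indpt T)"
    using maximal_exists_superset[of "set (cols G)" "\<lambda>T. T \<subseteq> set (cols G) \<and> lin_indpt T" "{}"]
      finite_lin_indpt2[of "{}"] by auto
  then have "T \<subseteq> carrier_vec m" "lin_indpt T" using cols_dim[of G] assms by (auto simp: maximal_def)
  then have "card T \<le> m" using li_le_dim(2)[of T] by (simp add: dim_is_n)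
  then show "vec_space.rank m G \<le> m" using rank_card_indpt[OF assms T] by simp
qed

lemma proots_linear_factors:
  "proots (\<Prod>a\<leftarrow>xs. [:- a, 1:]) = mset (xs :: complex list)"
proof (induction xs)
  case (Cons a xs)
  have "(\<Prod>a\<leftarrow>xs. [:- a, 1:]) \<noteq> 0" by (auto simp: prod_list_zero_iff)
  then have "proots ([:- a, 1:] * (\<Prod>a\<leftarrow>xs. [:- a, 1:])) = {#a#} + mset xs"
    using Cons by (subst proots_mult) (auto simp del: mult_pCons_left)
  then show ?case by (simp del: mult_pCons_left)
qed simp

text \<open>
  Since \<open>G\<^sup>*G\<close> is unitarily similar to a diagonal matrix with entries \<open>s\<^sub>i\<^sup>2\<close> for \<open>i < r\<close> and 0
  otherwise, the roots of its characteristic polynomial can be read off.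
\<close>
lemma singular_values_of_svd:
  fixes s :: "nat \<Rightarrow> real"
  assumes V: "unitary_mat m V" and W: "unitary_mat n W" and r: "r \<le> m" "r \<le> n"
    and G: "G = V * embed_block m n r (mat_diag r (\<lambda>j. complex_of_real (s j))) * mat_adjoint W"
  shows "singular_values G = take (min m n)
    (rev (sort (map (\<lambda>i. if i < r then \<bar>s i\<bar> else 0) [0..<n])))"
proof -
  have Vc: "V \<in> carrier_mat m m" and Wc: "W \<in> carrier_mat n n"
    using V W by (auto simp: unitary_mat_def)
  have Gc: "G \<in> carrier_mat m n" using Vc Wc unfolding G by (auto intro!: carrier_matI)
  let ?D = "embed_block n n r (mat_diag r (\<lambda>j. complex_of_real ((s j)\<^sup>2)))"
  note D = embed_block_diag[OF r(2) r(2)]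
  have Dc: "?D \<in> carrier_mat n n" by (simp add: D)
  have colG: "col G j = lin_comb m r (\<lambda>i. complex_of_real (s i) * cnj (W $$ (j, i))) (col V)"
    if "j < n" for j unfolding G by (rule col_svd_product[OF Vc Wc r that])
  have Vr: "orthonormal m r (col V)"
    using unitary_cols_orthonormal[OF V] r by (auto simp: orthonormal_def)
  have "mat_adjoint G * G = W * ?D * mat_adjoint W"
  proof (rule eq_matI)
    fix j l assume "j < dim_row (W * ?D * mat_adjoint W)" "l < dim_col (W * ?D * mat_adjoint W)"
    then have jl: "j < n" "l < n" using Wc by auto
    have "(mat_adjoint G * G) $$ (j, l) = col G l \<bullet>c col G j"
      using Gc jl by (simp add: scalar_prod_def mult.commute)
    also have "\<dots> = (\<Sum>i<r. cnj (complex_of_real (s i) * cnj (W $$ (j, i)))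
        * (col G l \<bullet>c col V i))"
      unfolding colG[OF jl(1)]
      by (rule cinner_lin_comb_right) (use Gc Vc jl in auto)
    also have "\<dots> = (\<Sum>i<r. complex_of_real ((s i)\<^sup>2) * cnj (W $$ (l, i)) * W $$ (j, i))"
      unfolding colG[OF jl(2)]
      by (intro sum.cong refl) (simp add: cinner_orthonormal_lin_comb[OF Vr] power2_eq_square)
    also have "\<dots> = col (W * ?D * mat_adjoint W) l $ j"
      unfolding col_svd_product[OF Wc Wc r(2) r(2) jl(2)]
      using jl Wc r by (simp add: lin_comb_def)
    finally show "(mat_adjoint G * G) $$ (j, l) = (W * ?D * mat_adjoint W) $$ (j, l)"
      using jl Wc by simp
  qed (use Gc Wc in auto)
  moreover have "mat_adjoint G * G \<in> carrier_mat n n" "mat_adjoint W \<in> carrier_mat n n"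
    using Gc Wc by (auto intro!: carrier_matI)
  ultimately have "similar_mat (mat_adjoint G * G) ?D"
    using W Dc by (intro similar_matI[of _ _ W "mat_adjoint W" n]) (auto simp: unitary_mat_def)
  then have "char_poly (mat_adjoint G * G) = char_poly ?D" by (rule char_poly_similar)
  also have "\<dots> = (\<Prod>a\<leftarrow>diag_mat ?D. [:- a, 1:])"
    by (rule char_poly_upper_triangular[OF Dc]) (auto simp: D)
  finally have "proots (char_poly (mat_adjoint G * G)) = mset (diag_mat ?D)"
    by (simp only: proots_linear_factors)
  also have "diag_mat ?D = map (\<lambda>i. if i < r then complex_of_real ((s i)\<^sup>2) else 0) [0..<n]"
    by (auto simp: diag_mat_def D)
  finally have eig: "image_mset (\<lambda>x. sqrt (Re x)) (proots (char_poly (mat_adjoint G * G)))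
      = mset (map (\<lambda>i. sqrt (Re (if i < r then complex_of_real ((s i)\<^sup>2) else 0))) [0..<n])"
    by (simp add: image_mset.compositionality comp_def)
  have "map (\<lambda>i. sqrt (Re (if i < r then complex_of_real ((s i)\<^sup>2) else 0))) [0..<n]
      = map (\<lambda>i. if i < r then \<bar>s i\<bar> else 0) [0..<n]"
    by auto
  then have "sorted_list_of_multiset (image_mset (\<lambda>x. sqrt (Re x)) (proots (char_poly (mat_adjoint G * G))))
      = sort (map (\<lambda>i. if i < r then \<bar>s i\<bar> else 0) [0..<n])"
    unfolding eig by (simp only: sorted_list_of_multiset_mset)
  then show ?thesis
    unfolding singular_values_def carrier_matD[OF Gc] by (rule arg_cong)
qed

text \<open>
  The list of singular values is defined by the characteristic polynomial of \<open>G\<^sup>*G\<close>, whereas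
  \<open>\<Sigma>\<close> only contains its first \<open>r\<close> entries. Comparing the whole list with the multiset of diagonal
  entries of \<open>\<Sigma>\<^sup>*\<Sigma>\<close> cancels these first \<open>r\<close> entries and leaves zeros for the others.
\<close>
lemma svd_singular_values:
  assumes svd: "is_svd G V \<Sigma> W" and G: "G \<in> carrier_mat m n" and r: "r = vec_space.rank m G"
  shows "i < min m n \<Longrightarrow> 0 \<le> singular_value G i"
    and "i \<le> j \<Longrightarrow> j < min m n \<Longrightarrow> singular_value G j \<le> singular_value G i"
    and "r \<le> j \<Longrightarrow> j < min m n \<Longrightarrow> singular_value G j = 0"
proof -
  note r_le = rank_le_dims[OF G, folded r]
  let ?M = "map (\<lambda>i. if i < r then \<bar>singular_value G i\<bar> else 0) [0..<n]"
  define L where "L = rev (sort ?M)"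
  have "unitary_mat m V" "unitary_mat n W"
    "G = V * embed_block m n r (mat_diag r (\<lambda>j. complex_of_real (singular_value G j))) * mat_adjoint W"
    using svd G unfolding is_svd_def Let_def r carrier_matD[OF G] by blast+
  from singular_values_of_svd[OF this(1,2) r_le this(3)]
  have L: "singular_values G = take (min m n) L" by (simp only: L_def)
  have len: "length L = n" by (simp add: L_def)
  have nn: "0 \<le> x" if "x \<in> set L" for x using that by (auto simp: L_def split: if_splits)
  have sv: "singular_value G i = L ! i" if "i < min m n" for i using that by (simp add: L)
  show nonneg: "0 \<le> singular_value G i" if "i < min m n" for i
    using that len by (simp add: sv nn)
  show "singular_value G j \<le> singular_value G i" if "i \<le> j" "j < min m n" for i j
  proof -
    have "sorted (rev L)" by (simp add: L_def)
    then have "L ! j \<le> L ! i"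
      using that len by (intro sorted_rev_nth_mono) auto
    then show ?thesis using that by (simp add: sv)
  qed
  have split: "[0..<n] = [0..<r] @ [r..<n]" using upt_add_eq_append[of 0 r "n - r"] r_le(2) by simp
  have first: "map (\<lambda>i. if i < r then \<bar>singular_value G i\<bar> else 0) [0..<r] = take r L"
    using r_le len by (intro nth_equalityI) (auto simp: sv abs_of_nonneg nn)
  have "mset L = mset (take r L) + mset (map (\<lambda>i. if i < r then \<bar>singular_value G i\<bar> else 0) [r..<n])"
    unfolding first[symmetric] unfolding L_def mset_rev mset_sort split map_append mset_append ..
  moreover have "mset L = mset (take r L) + mset (drop r L)"
    by (metis append_take_drop_id mset_append)
  ultimately have "mset (drop r L) = mset (map (\<lambda>i. if i < r then \<bar>singular_value G i\<bar> else 0) [r..<n])"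
    by simp
  then have "set (drop r L) = set (map (\<lambda>i. if i < r then \<bar>singular_value G i\<bar> else 0) [r..<n])"
    by (rule mset_eq_setD)
  then have zero: "set (drop r L) \<subseteq> {0}" by auto
  show "singular_value G j = 0" if j: "r \<le> j" "j < min m n" for j
  proof -
    have "drop r L ! (j - r) \<in> set (drop r L)" using j len by (intro nth_mem) auto
    then have "L ! j = 0" using zero j len by auto
    then show ?thesis using j by (simp add: sv)
  qed
qed

section \<open>Minimising the objective over the weights\<close>

text \<open>
  Replace \<open>l\<close> by \<open>\<Sum>\<^sub>i b\<^sub>i\<close>. The resulting \<open>\<Sum>\<^sub>i b\<^sub>i (1 - 2 s\<^sub>i)\<close> with weights in \<open>[0, 1]\<close> is least when
  the weight is 1 on the nonpositive terms and 0 on the others.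
\<close>
lemma weighted_sum_le_truncated:
  fixes s b :: "nat \<Rightarrow> real"
  assumes b: "\<And>i. i < r \<Longrightarrow> 0 \<le> b i" "\<And>i. i < r \<Longrightarrow> b i \<le> 1" and l: "(\<Sum>i<r. b i) \<le> l" and "k \<le> r"
    and "\<And>i. i < k \<Longrightarrow> 1 / 2 \<le> s i" and "\<And>i. k \<le> i \<Longrightarrow> i < r \<Longrightarrow> s i < 1 / 2"
  shows "(\<Sum>i<k. 1 - 2 * s i) \<le> l - 2 * (\<Sum>i<r. s i * b i)"
proof -
  have "(\<Sum>i<k. 1 - 2 * s i) = (\<Sum>i<r. if i < k then 1 - 2 * s i else 0)"
    using \<open>k \<le> r\<close> by (intro sum.mono_neutral_cong_left) auto
  also have "\<dots> \<le> (\<Sum>i<r. b i * (1 - 2 * s i))"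
  proof (intro sum_mono)
    fix i assume "i \<in> {..<r}"
    then have i: "i < r" by simp
    show "(if i < k then 1 - 2 * s i else 0) \<le> b i * (1 - 2 * s i)"
    proof (cases "i < k")
      case True
      then have "(1 - b i) * (1 - 2 * s i) \<le> 0"
        using assms(5)[OF True] b(2)[OF i] by (intro mult_nonneg_nonpos) auto
      then show ?thesis using True by (simp add: algebra_simps)
    next
      case False
      then show ?thesis using assms(6)[of i] b(1)[OF i] i by simp
    qed
  qed
  also have "\<dots> = (\<Sum>i<r. b i) - 2 * (\<Sum>i<r. s i * b i)"
    by (simp add: sum_distrib_left sum_subtractf[symmetric] algebra_simps)
  finally show ?thesis using l by simp
qed

text \<open>
  If all terms \<open>1 - 2 s\<^sub>i\<close> are positive, no weight at all would be best, so the constraint \<open>1 \<le> l\<close>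
  decides: the cheapest choice is total weight 1, placed on the largest \<open>s\<^sub>i\<close>.
\<close>
lemma weighted_sum_le_top:
  fixes s b :: "nat \<Rightarrow> real"
  assumes b: "\<And>i. i < r \<Longrightarrow> 0 \<le> b i" and l: "(\<Sum>i<r. b i) \<le> l" "1 \<le> l"
    and s: "0 \<le> s 0" "s 0 < 1 / 2" "\<And>i. i < r \<Longrightarrow> s i \<le> s 0"
  shows "1 - 2 * s 0 \<le> l - 2 * (\<Sum>i<r. s i * b i)"
proof -
  have "(\<Sum>i<r. s i * b i) \<le> (\<Sum>i<r. s 0 * b i)"
    using b s(3) by (intro sum_mono mult_right_mono) auto
  also have "\<dots> \<le> s 0 * l"
    unfolding sum_distrib_left[symmetric] using l(1) s(1) by (rule mult_left_mono)
  finally have "(\<Sum>i<r. s i * b i) \<le> s 0 * l" .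
  moreover have "0 \<le> (l - 1) * (1 - 2 * s 0)" using l(2) s(2) by simp
  ultimately show ?thesis by (simp add: algebra_simps)
qed

lemma downward_closed_eq_lessThan:
  fixes A :: "nat set"
  assumes "finite A" and down: "\<And>i j. j \<in> A \<Longrightarrow> i \<le> j \<Longrightarrow> i \<in> A"
  shows "A = {..<card A}"
proof -
  define p where "p = (LEAST x. x \<notin> A)"
  have "p \<notin> A"
    unfolding p_def by (rule LeastI_ex) (rule ex_new_if_finite[OF infinite_UNIV_nat assms(1)])
  moreover have "x \<in> A" if "x < p" for x
    using not_less_Least[of x "\<lambda>x. x \<notin> A"] that unfolding p_def by blast
  moreover have "x < p" if "x \<in> A" for x
    using down[OF that, of p] \<open>p \<notin> A\<close> by (cases "x < p") auto
  ultimately have "A = {..<p}" by auto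
  then show ?thesis by simp
qed

section \<open>The objective and the truncated decomposition\<close>

lemma cols_orthonormal_sum:
  assumes W: "unitary_mat n W" and "i < n" "l < n"
  shows "(\<Sum>j<n. W $$ (j, i) * cnj (W $$ (j, l))) = (if i = l then 1 else 0)"
proof -
  have "W \<in> carrier_mat n n" using W by (auto simp: unitary_mat_def)
  then have "(\<Sum>j<n. W $$ (j, i) * cnj (W $$ (j, l))) = col W i \<bullet>c col W l"
    using assms(2,3) by (subst cinner_sum[of _ n]) auto
  then show ?thesis using orthonormal_cinner[OF unitary_cols_orthonormal[OF W] assms(2,3)] by simp
qed

text \<open>
  As \<open>x\<^sub>j \<in> S\<close>, the vector \<open>f\<^sub>j\<close> may be replaced by \<open>P f\<^sub>j\<close> in the mixed term. Expanding \<open>P f\<^sub>j\<close> by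
  the singular value decomposition turns \<open>\<Sum>\<^sub>j \<langle>f\<^sub>j, x\<^sub>j\<rangle>\<close> into \<open>\<Sum>\<^sub>i s\<^sub>i \<langle>v\<^sub>i, X w\<^sub>i\<rangle>\<close>, where \<open>X\<close> is the
  synthesis matrix of \<open>x\<close> and \<open>w\<^sub>i\<close> is column \<open>i\<close> of \<open>W\<close>.
\<close>
lemma objective_expansion:
  assumes S: "csubspace m S" and f: "\<And>j. j < n \<Longrightarrow> f j \<in> carrier_vec m"
    and x: "\<And>j. j < n \<Longrightarrow> x j \<in> S" and v: "\<And>i. i < r \<Longrightarrow> v i \<in> carrier_vec m"
    and Pf: "\<And>j. j < n \<Longrightarrow> orth_proj m S *\<^sub>v f j
      = lin_comb m r (\<lambda>i. complex_of_real (s i) * cnj (W $$ (j, i))) v"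
  shows "(\<Sum>j<n. (cnorm (f j - x j))\<^sup>2) = (\<Sum>j<n. (cnorm (f j))\<^sup>2)
    - 2 * (\<Sum>i<r. s i * Re (v i \<bullet>c lin_comb m n (\<lambda>j. W $$ (j, i)) x)) + (\<Sum>j<n. (cnorm (x j))\<^sup>2)"
proof -
  have xc: "x j \<in> carrier_vec m" if "j < n" for j using x[OF that] S by (auto simp: csubspace_iff)
  have "(\<Sum>j<n. f j \<bullet>c x j) = (\<Sum>j<n. (orth_proj m S *\<^sub>v f j) \<bullet>c x j)"
    by (intro sum.cong refl) (simp add: cinner_orth_proj[OF S f x])
  also have "\<dots> = (\<Sum>j<n. \<Sum>i<r. complex_of_real (s i) * cnj (W $$ (j, i)) * (v i \<bullet>c x j))"
    by (intro sum.cong refl) (simp add: Pf cinner_lin_comb_left[OF xc])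
  also have "\<dots> = (\<Sum>i<r. \<Sum>j<n. complex_of_real (s i) * cnj (W $$ (j, i)) * (v i \<bullet>c x j))"
    by (rule sum.swap)
  also have "\<dots> = (\<Sum>i<r. complex_of_real (s i) * (v i \<bullet>c lin_comb m n (\<lambda>j. W $$ (j, i)) x))"
    by (intro sum.cong refl) (simp add: cinner_lin_comb_right[OF v xc] sum_distrib_left mult.assoc)
  finally have "Re (\<Sum>j<n. f j \<bullet>c x j)
      = (\<Sum>i<r. s i * Re (v i \<bullet>c lin_comb m n (\<lambda>j. W $$ (j, i)) x))"
    by simp
  moreover have "(\<Sum>j<n. (cnorm (f j - x j))\<^sup>2) = (\<Sum>j<n. (cnorm (f j))\<^sup>2)
      - 2 * Re (\<Sum>j<n. f j \<bullet>c x j) + (\<Sum>j<n. (cnorm (x j))\<^sup>2)"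
    by (simp add: cnorm_diff_sq[OF f xc] sum.distrib sum_subtractf sum_distrib_left)
  ultimately show ?thesis by simp
qed

text \<open>
  Every \<open>u\<^sub>j\<close>, hence every \<open>g\<close> in the span, is orthogonal to \<open>v\<^sub>k, \<dots>, v\<^sub>m\<^sub>-\<^sub>1\<close>. So the first \<open>k\<close> of the
  coefficients \<open>\<langle>g, v\<^sub>i\<rangle>\<close> already carry the norm of \<open>g\<close>, and the numbers \<open>\<langle>g, u\<^sub>j\<rangle>\<close> arise from them by
  the isometry with columns \<open>w\<^sub>0, \<dots>, w\<^sub>k\<^sub>-\<^sub>1\<close>.
\<close>
lemma truncated_svd_parseval:
  assumes V: "unitary_mat m V" and W: "unitary_mat n W" and k: "k \<le> m" "k \<le> n"
    and u: "\<And>j. j < n \<Longrightarrow> u j = lin_comb m k (\<lambda>i. cnj (W $$ (j, i))) (col V)"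
  shows "parseval_frame_for m n u (cspan m (u ` {..<n}))"
proof -
  let ?K = "cspan m (u ` {..<n})" and ?v = "col V"
  have v: "orthonormal m m ?v" by (rule unitary_cols_orthonormal[OF V])
  have uc: "u j \<in> carrier_vec m" if "j < n" for j using u[OF that] by simp
  then have "u ` {..<n} \<subseteq> carrier_vec m" by auto
  then have fr: "frame_for m n u ?K"
    using uc by (auto simp: frame_for_def intro: csubspace_cspan)
  have vT: "?v ` {k..<m} \<subseteq> carrier_vec m" using orthonormal_carrier[OF v] by auto
  have "u j \<bullet>c ?v i = 0" if "j < n" "k \<le> i" "i < m" for i j
    unfolding u[OF that(1)] cinner_lin_comb_left[OF orthonormal_carrier[OF v that(3)]]
    using that k by (intro sum.neutral) (auto simp: orthonormal_cinner[OF v])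
  then have "u ` {..<n} \<subseteq> orth_compl m (?v ` {k..<m})" using uc by (auto simp: orth_compl_def)
  \<comment> \<open>An orthogonal complement is a subspace, so it contains the span of what it contains.\<close>
  then have KT: "?K \<subseteq> orth_compl m (?v ` {k..<m})"
    by (rule cspan_least[OF csubspace_orth_compl[OF vT]])
  have "(\<Sum>j<n. (cmod (g \<bullet>c u j))\<^sup>2) = (cnorm g)\<^sup>2" if g: "g \<in> ?K" for g
  proof -
    have gc: "g \<in> carrier_vec m" and g0: "\<And>i. k \<le> i \<Longrightarrow> i < m \<Longrightarrow> g \<bullet>c ?v i = 0"
      using KT g by (auto simp: orth_compl_def)
    have gu: "g \<bullet>c u j = (\<Sum>i<k. W $$ (j, i) * (g \<bullet>c ?v i))" if "j < n" for j
      unfolding u[OF that]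
      using k by (subst cinner_lin_comb_right[OF gc]) (auto simp: orthonormal_carrier[OF v])
    have Wc: "W \<in> carrier_mat n n" using W by (auto simp: unitary_mat_def)
    have w: "orthonormal n k (col W)"
      using unitary_cols_orthonormal[OF W] k by (auto simp: orthonormal_def)
    have "(\<Sum>j<n. (cmod (g \<bullet>c u j))\<^sup>2) = (cnorm (lin_comb n k (\<lambda>i. g \<bullet>c ?v i) (col W)))\<^sup>2"
      using k Wc by (auto simp: cnorm_sq_sum[of _ n] lin_comb_def gu mult.commute intro!: sum.cong)
    also have "\<dots> = (\<Sum>i<k. (cmod (g \<bullet>c ?v i))\<^sup>2)" by (rule cnorm_orthonormal_lin_comb[OF w])
    also have "\<dots> = (\<Sum>i<m. (cmod (g \<bullet>c ?v i))\<^sup>2)"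
      using k by (intro sum.mono_neutral_left) (auto simp: g0)
    also have "\<dots> = (cnorm g)\<^sup>2" by (rule unitary_Parseval[OF V gc])
    finally show ?thesis .
  qed
  with fr show ?thesis by (simp add: parseval_frame_for_def)
qed

lemma truncated_svd_synthesis:
  assumes V: "V \<in> carrier_mat m m" and W: "unitary_mat n W" and k: "k \<le> m" "k \<le> n" and i: "i < n"
    and u: "\<And>j. j < n \<Longrightarrow> u j = lin_comb m k (\<lambda>i. cnj (W $$ (j, i))) (col V)"
  shows "lin_comb m n (\<lambda>j. W $$ (j, i)) u = (if i < k then col V i else 0\<^sub>v m)"
proof (rule eq_vecI)
  fix a assume "a < dim_vec (if i < k then col V i else 0\<^sub>v m)"
  then have a: "a < m" using V by (auto split: if_splits)
  have "lin_comb m n (\<lambda>j. W $$ (j, i)) u $ a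
      = (\<Sum>j<n. \<Sum>l<k. V $$ (a, l) * (W $$ (j, i) * cnj (W $$ (j, l))))"
    using a V k by (simp add: lin_comb_def u sum_distrib_left ac_simps)
  also have "\<dots> = (\<Sum>l<k. V $$ (a, l) * (\<Sum>j<n. W $$ (j, i) * cnj (W $$ (j, l))))"
    by (subst sum.swap) (simp add: sum_distrib_left)
  also have "\<dots> = (\<Sum>l<k. if l = i then V $$ (a, l) else 0)"
    using k i by (intro sum.cong refl) (auto simp: cols_orthonormal_sum[OF W])
  also have "\<dots> = (if i < k then V $$ (a, i) else 0)" by simp
  finally show "lin_comb m n (\<lambda>j. W $$ (j, i)) u $ a = (if i < k then col V i else 0\<^sub>v m) $ a"
    using a V k by auto
qed (use V in \<open>simp add: lin_comb_def\<close>)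

text \<open>
  \<open>v\<^sub>i = s\<^sub>i\<^sup>-\<^sup>1 G w\<^sub>i\<close>, a combination of the columns \<open>g\<^sub>j\<close> of \<open>G\<close>.
\<close>
lemma singular_vector_in_csubspace:
  assumes S: "csubspace m S" and V: "V \<in> carrier_mat m m" and W: "unitary_mat n W"
    and r: "r \<le> m" "r \<le> n" and i: "i < r" and si: "s i \<noteq> (0 :: real)"
    and g: "\<And>j. j < n \<Longrightarrow> g j = lin_comb m r (\<lambda>l. complex_of_real (s l) * cnj (W $$ (j, l))) (col V)"
    and gS: "\<And>j. j < n \<Longrightarrow> g j \<in> S"
  shows "col V i \<in> S"
proof -
  have "col V i = lin_comb m n (\<lambda>j. W $$ (j, i) / complex_of_real (s i)) g"
  proof (rule eq_vecI)
    fix a assume "a < dim_vec (lin_comb m n (\<lambda>j. W $$ (j, i) / complex_of_real (s i)) g)"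
    then have a: "a < m" by (simp add: lin_comb_def)
    let ?c = "\<lambda>l. complex_of_real (s l) / complex_of_real (s i)"
    have "lin_comb m n (\<lambda>j. W $$ (j, i) / complex_of_real (s i)) g $ a
        = (\<Sum>j<n. \<Sum>l<r. ?c l * V $$ (a, l) * (W $$ (j, i) * cnj (W $$ (j, l))))"
      using a V r by (simp add: lin_comb_def g sum_distrib_left sum_divide_distrib ac_simps)
    also have "\<dots> = (\<Sum>l<r. ?c l * V $$ (a, l) * (\<Sum>j<n. W $$ (j, i) * cnj (W $$ (j, l))))"
      by (subst sum.swap) (simp add: sum_distrib_left)
    also have "\<dots> = (\<Sum>l<r. if l = i then ?c l * V $$ (a, l) else 0)"
      using r i by (intro sum.cong refl) (auto simp: cols_orthonormal_sum[OF W])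
    also have "\<dots> = V $$ (a, i)" using i si by simp
    finally show "col V i $ a = lin_comb m n (\<lambda>j. W $$ (j, i) / complex_of_real (s i)) g $ a"
      using a V i r by simp
  qed (use V in \<open>simp add: lin_comb_def\<close>)
  moreover have "lin_comb m n (\<lambda>j. W $$ (j, i) / complex_of_real (s i)) g \<in> S"
    by (rule lin_comb_in_csubspace[OF S gS])
  ultimately show ?thesis by (rule ssubst)
qed

lemma sum_cnorm_truncated_svd:
  assumes V: "unitary_mat m V" and W: "unitary_mat n W" and k: "k \<le> m" "k \<le> n"
    and u: "\<And>j. j < n \<Longrightarrow> u j = lin_comb m k (\<lambda>i. cnj (W $$ (j, i))) (col V)"
  shows "(\<Sum>j<n. (cnorm (u j))\<^sup>2) = real k"
proof -
  have v: "orthonormal m m (col V)" by (rule unitary_cols_orthonormal[OF V])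
  have Vc: "V \<in> carrier_mat m m" using V by (auto simp: unitary_mat_def)
  have "(\<Sum>j<n. (cnorm (u j))\<^sup>2) = (\<Sum>i<n. (cnorm (lin_comb m n (\<lambda>j. W $$ (j, i)) u))\<^sup>2)"
    by (rule sum_cnorm_synthesis_unitary[OF W, symmetric]) (simp add: u)
  also have "\<dots> = (\<Sum>i<n. if i < k then 1 else 0)"
    using k by (intro sum.cong refl)
      (auto simp: truncated_svd_synthesis[OF Vc W k _ u] cnorm_def orthonormal_cinner[OF v])
  also have "\<dots> = (\<Sum>i<k. 1)" using k by (intro sum.mono_neutral_cong_right) auto
  finally show ?thesis by simp
qed

theorem theorem4p6:
  fixes m n k :: nat
    and f :: "nat \<Rightarrow> complex vec"
    and K S :: "complex vec set"
    and F G V \<Sigma> W :: "complex mat"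
  assumes "frame_for m n f K"
    and "F = synthesis_mat m n f"
    and "csubspace m S"
    and "\<not> K \<subseteq> orth_compl m S"
    and "G = orth_proj m S * F"
    and "k = (if \<forall>j < min m n. singular_value G j < 1 / 2 then 1
              else card {j. j < min m n \<and> singular_value G j \<ge> 1 / 2})"
    and "is_svd G V \<Sigma> W"
  shows "symmetric_approximation n (n_parseval_frames_in m n S) f
           (\<lambda>j. (V * embed_block m n k (1\<^sub>m k) * mat_adjoint W) *\<^sub>v unit_vec n j)"
proof -
  note S = assms(3)
  let ?P = "orth_proj m S"
  have Pc: "?P \<in> carrier_mat m m" by (rule orth_proj_carrier[OF S])
  have f: "f j \<in> carrier_vec m" if "j < n" for j using assms(1) that by (simp add: frame_for_def)
  have Fc: "F \<in> carrier_mat m n" by (auto simp: assms(2) synthesis_mat_def intro!: carrier_matI)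
  have Gc: "G \<in> carrier_mat m n" using Pc Fc by (simp add: assms(5))
  define r where "r = vec_space.rank m G"
  define s where "s = singular_value G"
  note r = rank_le_dims[OF Gc, folded r_def]
  have V: "unitary_mat m V" and W: "unitary_mat n W"
    and G_svd: "G = V * embed_block m n r (mat_diag r (\<lambda>j. complex_of_real (s j))) * mat_adjoint W"
    using assms(7) unfolding is_svd_def Let_def carrier_matD[OF Gc] r_def[symmetric] s_def by blast+
  have Vc: "V \<in> carrier_mat m m" and Wc: "W \<in> carrier_mat n n"
    using V W by (auto simp: unitary_mat_def)
  have v: "orthonormal m m (col V)" by (rule unitary_cols_orthonormal[OF V])
  have vc: "col V i \<in> carrier_vec m" for i using Vc col_dim[of V i] by simp
  note sv = svd_singular_values[OF assms(7) Gc r_def, folded s_def]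
  have Pf: "?P *\<^sub>v f j = lin_comb m r (\<lambda>i. complex_of_real (s i) * cnj (W $$ (j, i))) (col V)"
    if j: "j < n" for j
  proof -
    have "col G j = ?P *\<^sub>v f j"
      using j Fc f[OF j] unfolding assms(5) by (subst col_mult2[OF Pc Fc j])
        (simp add: assms(2) synthesis_mat_def col_mat_of_cols)
    then show ?thesis unfolding G_svd col_svd_product[OF Vc Wc r j] by (rule sym)
  qed
  \<comment> \<open>Otherwise \<open>P\<close> annihilates every \<open>f\<^sub>j\<close>, so that \<open>K\<close> lies in the orthogonal complement of \<open>S\<close>.\<close>
  have "\<exists>i<r. s i \<noteq> 0"
  proof (rule ccontr)
    assume "\<not> (\<exists>i<r. s i \<noteq> 0)"
    then have "?P *\<^sub>v f j = 0\<^sub>v m" if "j < n" for j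
      unfolding Pf[OF that] by (intro eq_vecI) (auto simp: lin_comb_def)
    moreover have "f j - ?P *\<^sub>v f j \<in> orth_compl m S" if "j < n" for j
      using orth_proj_properties[OF S] f[OF that] by blast
    ultimately have "f j - 0\<^sub>v m \<in> orth_compl m S" if "j < n" for j using that by metis
    moreover have "f j - 0\<^sub>v m = f j" if "j < n" for j using f[OF that] by auto
    ultimately have "f ` {..<n} \<subseteq> orth_compl m S" by auto
    moreover have "S \<subseteq> carrier_vec m" using S by (simp add: csubspace_iff)
    ultimately have "cspan m (f ` {..<n}) \<subseteq> orth_compl m S"
      by (intro cspan_least csubspace_orth_compl)
    then show False using assms(1,4) by (simp add: frame_for_def)
  qed
  then obtain i0 where i0: "i0 < r" "s i0 \<noteq> 0" by blast
  then have s0: "0 < s 0" using sv(1)[of i0] sv(2)[of 0 i0] r by fastforce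
  have r0: "0 < r" using i0 by simp
  let ?small = "\<forall>j<min m n. s j < 1 / 2"
  have k_small: "k = 1" if ?small using that assms(6) by (simp add: s_def)
  have k_large: "{j. j < min m n \<and> 1 / 2 \<le> s j} = {..<k}" if "\<not> ?small"
  proof -
    have "{j. j < min m n \<and> 1 / 2 \<le> s j} = {..<card {j. j < min m n \<and> 1 / 2 \<le> s j}}"
      by (rule downward_closed_eq_lessThan) (use sv(2) in force)+
    moreover have "k = card {j. j < min m n \<and> 1 / 2 \<le> s j}"
      using that assms(6) unfolding s_def by (simp only: if_False)
    ultimately show ?thesis by simp
  qed
  \<comment> \<open>Positivity of the first \<open>k\<close> singular values is what puts \<open>v\<^sub>0, \<dots>, v\<^sub>k\<^sub>-\<^sub>1\<close> into \<open>S\<close>.\<close>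
  have k: "0 < k \<and> k \<le> r \<and> (\<forall>i<k. 0 < s i)"
  proof (cases ?small)
    case True
    then show ?thesis using k_small r0 s0 by simp
  next
    case False
    have pos: "i < min m n \<and> 1 / 2 \<le> s i" if "i < k" for i using k_large[OF False] that by blast
    have "i < r" if "i < k" for i using pos[OF that] sv(3)[of i] by (cases "i < r") auto
    then have "k \<le> r" by (meson not_less less_irrefl)
    moreover have "k \<noteq> 0" using k_large[OF False] False by force
    ultimately show ?thesis using pos by fastforce
  qed
  have km: "k \<le> m" and kn: "k \<le> n" using k r by auto
  define u where "u j = (V * embed_block m n k (1\<^sub>m k) * mat_adjoint W) *\<^sub>v unit_vec n j" for j
  have u: "u j = lin_comb m k (\<lambda>i. cnj (W $$ (j, i))) (col V)" if j: "j < n" for j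
  proof -
    have "V * embed_block m n k (1\<^sub>m k) * mat_adjoint W \<in> carrier_mat m n"
      using Vc Wc by (auto intro!: carrier_matI)
    then have "u j = col (V * embed_block m n k (mat_diag k (\<lambda>_. 1)) * mat_adjoint W) j"
      using j unfolding u_def by (intro eq_vecI) (auto simp: scalar_prod_right_unit[of _ n])
    then show ?thesis using col_svd_product[OF Vc Wc km kn j, of "\<lambda>_. 1"] by simp
  qed
  note u_syn = truncated_svd_synthesis[OF Vc W km kn _ u]
  have vS: "col V i \<in> S" if "i < k" for i
    using that k orth_proj_in[OF S f]
    by (intro singular_vector_in_csubspace[OF S Vc W r _ _ Pf]) auto
  have uS: "u j \<in> S" if "j < n" for j
    unfolding u[OF that] by (rule lin_comb_in_csubspace[OF S vS])
  have uP: "parseval_frame_for m n u (cspan m (u ` {..<n}))"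
    by (rule truncated_svd_parseval[OF V W km kn u])
  have "cspan m (u ` {..<n}) \<noteq> {0\<^sub>v m}"
  proof
    assume K0: "cspan m (u ` {..<n}) = {0\<^sub>v m}"
    have "lin_comb m n (\<lambda>j. W $$ (j, 0)) u \<in> cspan m (u ` {..<n})"
      using parseval_frame_forD[OF uP] by (intro lin_comb_in_csubspace) auto
    then have "col V 0 = 0\<^sub>v m" using u_syn[of 0] K0 k kn by simp
    then show False using orthonormal_cinner[OF v, of 0 0] k km by auto
  qed
  then have uJ: "u \<in> n_parseval_frames_in m n S"
    using uP uS by (auto simp: n_parseval_frames_in_def n_parseval_frame_def)
  have obj: "(\<Sum>j<n. (cnorm (f j - x j))\<^sup>2) = (\<Sum>j<n. (cnorm (f j))\<^sup>2)
      - 2 * (\<Sum>i<r. s i * Re (col V i \<bullet>c lin_comb m n (\<lambda>j. W $$ (j, i)) x))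
      + (\<Sum>j<n. (cnorm (x j))\<^sup>2)" if "\<And>j. j < n \<Longrightarrow> x j \<in> S" for x
    by (rule objective_expansion[OF S f that vc Pf])
  have "(\<Sum>j<n. (cnorm (f j - u j))\<^sup>2) = (\<Sum>j<n. (cnorm (f j))\<^sup>2) + (\<Sum>i<k. 1 - 2 * s i)"
  proof -
    have "(\<Sum>i<r. s i * Re (col V i \<bullet>c lin_comb m n (\<lambda>j. W $$ (j, i)) u)) = (\<Sum>i<r. if i < k then s i else 0)"
      using r km by (intro sum.cong refl) (auto simp: u_syn orthonormal_cinner[OF v] vc)
    also have "\<dots> = (\<Sum>i<k. s i)" using k by (intro sum.mono_neutral_cong_right) auto
    finally have "(\<Sum>i<r. s i * Re (col V i \<bullet>c lin_comb m n (\<lambda>j. W $$ (j, i)) u)) = (\<Sum>i<k. s i)" .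
    moreover have "(\<Sum>j<n. (cnorm (u j))\<^sup>2) = real k"
      by (rule sum_cnorm_truncated_svd[OF V W km kn u])
    ultimately show ?thesis
      using obj[of u] uS by (simp add: sum_subtractf sum_distrib_left)
  qed
  moreover have "(\<Sum>j<n. (cnorm (f j))\<^sup>2) + (\<Sum>i<k. 1 - 2 * s i) \<le> (\<Sum>j<n. (cnorm (f j - x j))\<^sup>2)"
    if x: "x \<in> n_parseval_frames_in m n S" for x
  proof -
    obtain K' where K0: "K' \<noteq> {0\<^sub>v m}" and xP: "parseval_frame_for m n x K'"
      using x by (auto simp: n_parseval_frames_in_def n_parseval_frame_def)
    have xS: "x j \<in> S" if "j < n" for j using x that by (simp add: n_parseval_frames_in_def)
    have xc: "x j \<in> carrier_vec m" if "j < n" for j by (rule parseval_frame_forD(3)[OF xP that])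
    define l where "l = (\<Sum>j<n. (cnorm (x j))\<^sup>2)"
    define p where "p i = (\<Sum>j<n. (cmod (col V i \<bullet>c x j))\<^sup>2)" for i
    define q where "q i = (cnorm (lin_comb m n (\<lambda>j. W $$ (j, i)) x))\<^sup>2" for i
    \<comment> \<open>The weight \<open>b\<^sub>i\<close> bounds \<open>Re \<langle>v\<^sub>i, X w\<^sub>i\<rangle>\<close>; \<open>p\<^sub>i\<close> is \<open>\<parallel>X\<^sup>* v\<^sub>i\<parallel>\<^sup>2\<close> and \<open>q\<^sub>i\<close> is \<open>\<parallel>X w\<^sub>i\<parallel>\<^sup>2\<close>.\<close>
    define b where "b i = (p i + q i) / 2" for i
    have b0: "0 \<le> b i" for i by (simp add: b_def p_def q_def sum_nonneg)
    have b1: "b i \<le> 1" if i: "i < r" for i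
    proof -
      have "p i \<le> (cnorm (col V i))\<^sup>2" unfolding p_def by (rule parseval_analysis_le[OF xP vc])
      also have "\<dots> = 1" using orthonormal_cinner[OF v, of i i] i r by (simp add: cnorm_def)
      finally have "p i \<le> 1" .
      moreover have "q i \<le> (\<Sum>j<n. (cmod (W $$ (j, i)))\<^sup>2)"
        unfolding q_def by (rule parseval_synthesis_le[OF xP])
      moreover have "(\<Sum>j<n. (cmod (W $$ (j, i)))\<^sup>2) = 1"
      proof -
        have "complex_of_real (\<Sum>j<n. (cmod (W $$ (j, i)))\<^sup>2) = 1"
          using cols_orthonormal_sum[OF W, of i i] i r
          by (simp only: of_real_sum complex_norm_square) simp
        then show ?thesis by (simp only: of_real_eq_1_iff)
      qed
      ultimately show ?thesis by (simp add: b_def)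
    qed
    have bl: "(\<Sum>i<r. b i) \<le> l"
    proof -
      have "(\<Sum>i<r. p i) \<le> (\<Sum>i<m. p i)"
        using r by (intro sum_mono2) (auto simp: p_def sum_nonneg)
      also have "\<dots> = (\<Sum>j<n. \<Sum>i<m. (cmod (x j \<bullet>c col V i))\<^sup>2)"
        unfolding p_def by (subst sum.swap) (simp add: cinner_commute[OF xc vc])
      also have "\<dots> = l" unfolding l_def by (simp add: unitary_Parseval[OF V xc])
      finally have "(\<Sum>i<r. p i) \<le> l" .
      moreover have "(\<Sum>i<r. q i) \<le> (\<Sum>i<n. q i)"
        using r by (intro sum_mono2) (auto simp: q_def)
      moreover have "(\<Sum>i<n. q i) = l"
        unfolding q_def l_def by (rule sum_cnorm_synthesis_unitary[OF W xc])
      ultimately show ?thesis unfolding b_def sum_divide_distrib[symmetric] sum.distrib by argo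
    qed
    have l1: "1 \<le> l" unfolding l_def by (rule parseval_norm_ge_1[OF xP K0])
    have "(\<Sum>i<r. s i * Re (col V i \<bullet>c lin_comb m n (\<lambda>j. W $$ (j, i)) x)) \<le> (\<Sum>i<r. s i * b i)"
      using r sv(1) parseval_synthesis_cinner_le[OF xP vc]
      by (intro sum_mono mult_left_mono) (auto simp: b_def p_def q_def)
    moreover have "(\<Sum>i<k. 1 - 2 * s i) \<le> l - 2 * (\<Sum>i<r. s i * b i)"
    proof (cases ?small)
      case True
      have "1 - 2 * s 0 \<le> l - 2 * (\<Sum>i<r. s i * b i)"
        using True r r0 s0 sv(2)[of 0] by (intro weighted_sum_le_top b0 bl l1) auto
      then show ?thesis using k_small[OF True] by simp
    next
      case False
      have "1 / 2 \<le> s i" if "i < k" for i using k_large[OF False] that by blast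
      moreover have "s i < 1 / 2" if "k \<le> i" "i < r" for i
      proof -
        have "i \<notin> {j. j < min m n \<and> 1 / 2 \<le> s j}" unfolding k_large[OF False] using that by simp
        then show ?thesis using that r by simp
      qed
      ultimately show ?thesis using k b0 b1 bl by (intro weighted_sum_le_truncated) auto
    qed
    ultimately show ?thesis using obj[of x] xS by (simp add: l_def[symmetric])
  qed
  ultimately have "symmetric_approximation n (n_parseval_frames_in m n S) f u"
    using uJ by (simp add: symmetric_approximation_def)
  then show ?thesis by (simp add: u_def[abs_def])
qed

end
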